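(* The function $g_{H_1}(t):=H_1(e^t)-H_1(1)$ $(t\in\mathbb{R})$ is a screw function on $\mathbb{R}$ if and only if the Riemann hypothesis holds.
   Context: For $X>0$, $H_1(X):=\sum_{\rho}\frac{X^{\rho-1/2}}{\rho(1-\rho)}$, where the (absolutely convergent) sum runs over all nontrivial zeros $\rho$ of the Riemann zeta function $\zeta(s)$ (zeros with $0<\Re(\rho)<1$), counted with multiplicity. The Riemann hypothesis asserts $\Re(\rho)=1/2$ for all nontrivial zeros. A continuous function $g:\mathbb{R}\to\mathbb{C}$ is called a screw function on $\mathbb{R}$ if $g(-t)=\overline{g(t)}$ for all $t\in\mathbb{R}$ and the kernel $G_g(t,u):=g(t-u)-g(t)-g(-u)+g(0)$ is nonnegative definite on $\mathbb{R}\times\mathbb{R}$, i.e. $\sum_{i,j=1}^n G_g(t_i,t_j)\,\xi_i\overline{\xi_j}\ge 0$ for all $n\in\mathbb{Z}_{>0}$, $t_i\in\mathbb{R}$, $\xi_i\in\mathbb{C}$. *)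

theory Defs
  imports "HOL-Complex_Analysis.Complex_Analysis"
begin

text \<open>
  The Riemann zeta function is the analytic continuation of the Dirichlet series
  \<open>\<Sum>n\<ge>1. n powr (-s)\<close> from \<open>Re s > 1\<close> to the complex plane without the pole \<open>s = 1\<close>.
  By the identity theorem the continuation is unique; the otherwise arbitrary value at the
  pole is set to \<open>0\<close>.
\<close>

definition riemann_zeta :: "complex \<Rightarrow> complex" where
  "riemann_zeta = (THE f.
     f holomorphic_on (- {1}) \<and>
     (\<forall>s. Re s > 1 \<longrightarrow> f s = (\<Sum>n. 1 / (of_nat (Suc n) powr s))) \<and>
     f 1 = 0)"

definition nontrivial_zeros :: "complex set" where
  "nontrivial_zeros = {\<rho>. 0 < Re \<rho> \<and> Re \<rho> < 1 \<and> riemann_zeta \<rho> = 0}"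

definition Riemann_Hypothesis :: bool where
  "Riemann_Hypothesis \<longleftrightarrow> (\<forall>\<rho>\<in>nontrivial_zeros. Re \<rho> = 1 / 2)"

text \<open>
  The sum runs over the set of distinct zeros, each term being weighted with the multiplicity
  \<open>zorder riemann_zeta \<rho>\<close> of the zero. The series converges absolutely, so no ordering of the
  zeros has to be chosen. Only values at \<open>X > 0\<close> are meaningful.
\<close>

definition H1 :: "real \<Rightarrow> complex" where
  "H1 X = (\<Sum>\<^sub>\<infinity>\<rho>\<in>nontrivial_zeros.
     of_int (zorder riemann_zeta \<rho>) * (of_real X powr (\<rho> - 1 / 2) / (\<rho> * (1 - \<rho>))))"

definition g_H1 :: "real \<Rightarrow> complex" where
  "g_H1 t = H1 (exp t) - H1 1"

definition screw_kernel :: "(real \<Rightarrow> complex) \<Rightarrow> real \<Rightarrow> real \<Rightarrow> complex" where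
  "screw_kernel g t u = g (t - u) - g t - g (- u) + g 0"

text \<open>
  Membership in \<open>\<real>\<^sub>\<ge>\<^sub>0\<close> says that the complex number is real and nonnegative.
\<close>

definition nonneg_definite_kernel :: "(real \<Rightarrow> real \<Rightarrow> complex) \<Rightarrow> bool" where
  "nonneg_definite_kernel G \<longleftrightarrow>
     (\<forall>n>0. \<forall>(t :: nat \<Rightarrow> real) (\<xi> :: nat \<Rightarrow> complex).
        (\<Sum>i=1..n. \<Sum>j=1..n. G (t i) (t j) * \<xi> i * cnj (\<xi> j)) \<in> \<real>\<^sub>\<ge>\<^sub>0)"

definition screw_function :: "(real \<Rightarrow> complex) \<Rightarrow> bool" where
  "screw_function g \<longleftrightarrow>
     continuous_on UNIV g \<and>
     (\<forall>t. g (- t) = cnj (g t)) \<and>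
     nonneg_definite_kernel (screw_kernel g)"

end

theory Submission
  imports Defs "HOL-Real_Asymp.Real_Asymp"
begin

text \<open>
  Repeated integration by parts against periodic functions of mean zero continues the zeta function
  and bounds it polynomially on right half-planes. Dividing out zeros and applying the maximum
  principle on discs around \<open>2 + iT\<close> then gives \<open>O(T\<^sup>1\<^sup>/\<^sup>2)\<close> zeros near height \<open>T\<close>, so the
  sum defining \<open>H1\<close> converges absolutely.

  If all zeros lie on the critical line, the kernel is a sum of positive multiples of the rank one
  kernels \<open>(e\<^bsup>i\<gamma>t\<^esup> - 1) cnj (e\<^bsup>i\<gamma>u\<^esup> - 1)\<close>. Conversely, if \<open>g\<close> is a screw function,
  then \<open>\<phi>(t) = -g(t) - g(-t) = G(t, t)\<close> satisfies \<open>0 \<le> \<phi>(2t) \<le> 4 \<phi>(t)\<close>, hence grows at most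
  quadratically, and its Laplace transform is holomorphic for \<open>Re z > 0\<close>. This transform has poles
  at \<open>\<plusminus>(\<rho> - 1/2)\<close>, where equal poles cannot cancel: the weights of \<open>\<rho>\<close> and \<open>1 - \<rho>\<close> are positive
  multiples of the same number. So no \<open>\<plusminus>(\<rho> - 1/2)\<close> has positive real part; using both signs
  replaces the functional equation.
\<close>

section \<open>Holomorphic infinite sums\<close>

text \<open>An infinite sum that does not converge has the default value \<open>0\<close>, so both
  directions rest on absolute convergence of the series for \<open>H1\<close>. Its terms have size
  multiplicity / |\<rho>|^2, hence any bound O(T^c) with c < 1 for the zeros in a unit window is
  enough; the exponent 1/2 stems from ln x \<le> 2 sqrt x. In the converse direction, the obstacle
  is that the individual terms are only known to be O(exp (|t| / 2)), so the transform can be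
  computed term by term only to the right of all possible poles; this is done for
  \<open>Re z \<ge> 1\<close>. Positivity enters through configurations of one and two points, and
  only as a growth bound. Subexponential growth makes the same transform holomorphic up to the
  imaginary axis, and the identity theorem carries the formula from \<open>Re z > 1\<close> to the
  place where a zero off the critical line would force a pole.\<close>

lemma holomorphic_on_infsum:
  fixes f :: "'i \<Rightarrow> complex \<Rightarrow> complex"
  assumes S: "open S" and hol: "\<And>i. i \<in> I \<Longrightarrow> f i holomorphic_on S"
    and bound: "\<And>z. z \<in> S \<Longrightarrow> \<exists>d>0. \<exists>M. cball z d \<subseteq> S \<and> M summable_on I \<and>
                  (\<forall>i\<in>I. \<forall>w\<in>cball z d. norm (f i w) \<le> M i)"
  shows "(\<lambda>z. \<Sum>\<^sub>\<infinity>i\<in>I. f i z) holomorphic_on S"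
proof -
  have "\<exists>d>0. (\<lambda>z. \<Sum>\<^sub>\<infinity>i\<in>I. f i z) holomorphic_on ball z d" if z: "z \<in> S" for z
  proof -
    obtain d M where d: "d > 0" "cball z d \<subseteq> S" "M summable_on I"
      "\<And>i w. i \<in> I \<Longrightarrow> w \<in> cball z d \<Longrightarrow> norm (f i w) \<le> M i"
      using bound[OF z] by blast
    \<comment> \<open>The M-test is taken in the filter of finite subsets: no enumeration of
      \<open>I\<close> is chosen, so sums over naturals and over zeros are treated alike.\<close>
    have lim: "uniform_limit (cball z d) (\<lambda>X y. \<Sum>i\<in>X. f i y) (\<lambda>y. \<Sum>\<^sub>\<infinity>i\<in>I. f i y) (finite_subsets_at_top I)"
      by (rule Weierstrass_m_test_general) (use d in auto)
    have "\<forall>\<^sub>F X in finite_subsets_at_top I. continuous_on (cball z d) (\<lambda>y. \<Sum>i\<in>X. f i y)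
            \<and> (\<lambda>y. \<Sum>i\<in>X. f i y) holomorphic_on ball z d"
      unfolding eventually_finite_subsets_at_top
    proof (intro exI[of _ "{}"] conjI allI impI)
      fix Y assume Y: "finite Y \<and> {} \<subseteq> Y \<and> Y \<subseteq> I"
      have hY: "(\<lambda>y. \<Sum>i\<in>Y. f i y) holomorphic_on S"
        using Y hol by (intro holomorphic_intros) auto
      show "continuous_on (cball z d) (\<lambda>y. \<Sum>i\<in>Y. f i y)"
        using hY d holomorphic_on_imp_continuous_on continuous_on_subset by blast
      show "(\<lambda>y. \<Sum>i\<in>Y. f i y) holomorphic_on ball z d"
        using hY d ball_subset_cball holomorphic_on_subset by blast
    qed auto
    from holomorphic_uniform_limit[OF this lim] show ?thesis
      using d(1) by auto
  qed
  then show ?thesis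
    by (intro analytic_imp_holomorphic) (auto simp: analytic_on_def)
qed

section \<open>Analytic continuation and growth of zeta\<close>

text \<open>This agrees with \<open>powr\<close> at positive reals, but with the real logarithm
  inside \<open>exp\<close> it is visibly entire in \<open>s\<close>, and the derivative in the real
  variable \<open>x\<close> follows from the chain rule.\<close>

definition cpow :: "real \<Rightarrow> complex \<Rightarrow> complex" where
  "cpow x s = exp (s * of_real (ln x))"

lemma norm_cpow: "x > 0 \<Longrightarrow> norm (cpow x s) = x powr Re s"
  by (simp add: cpow_def powr_def)

lemma cpow_1 [simp]: "cpow 1 s = 1"
  by (simp add: cpow_def)

lemma of_nat_powr_eq_cpow: "n > 0 \<Longrightarrow> of_nat n powr s = cpow (real n) s"
  by (simp add: cpow_def powr_def Ln_of_nat)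

lemma cpow_has_vector_derivative:
  assumes "x > 0"
  shows "((\<lambda>x. cpow x s) has_vector_derivative s * cpow x (s - 1)) (at x within A)"
proof -
  have "((\<lambda>x. complex_of_real (ln x)) has_vector_derivative of_real (1 / x)) (at x within A)"
    using assms by (auto intro!: has_vector_derivative_of_real derivative_eq_intros
        simp: has_real_derivative_iff_has_vector_derivative[symmetric])
  moreover have "((\<lambda>y. exp (s * y)) has_field_derivative s * exp (s * of_real (ln x)))
      (at (complex_of_real (ln x)))"
    by (auto intro!: derivative_eq_intros)
  ultimately have "((\<lambda>y. exp (s * y)) \<circ> (\<lambda>x. complex_of_real (ln x)) has_vector_derivative
      of_real (1 / x) * (s * exp (s * of_real (ln x)))) (at x within A)"
    by (rule field_vector_diff_chain_within[OF _ has_field_derivative_at_within])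
  moreover have "of_real (1 / x) * exp (s * of_real (ln x)) = cpow x (s - 1)"
  proof -
    have "cpow x (s - 1) = exp (s * of_real (ln x)) * exp (- complex_of_real (ln x))"
      by (simp add: cpow_def algebra_simps exp_diff exp_minus divide_simps)
    also have "exp (- complex_of_real (ln x)) = of_real (exp (- ln x))"
      by (simp flip: exp_of_real)
    also have "exp (- ln x) = 1 / x"
      using assms by (simp add: exp_minus divide_simps)
    finally show ?thesis by simp
  qed
  ultimately show ?thesis
    by (simp add: cpow_def comp_def mult_ac flip: times_divide_eq_right)
qed

section \<open>Mellin transforms of periodic functions, one unit interval at a time\<close>

definition unit_term :: "(real \<Rightarrow> complex) \<Rightarrow> nat \<Rightarrow> complex \<Rightarrow> complex" where
  "unit_term P n s = integral {0..1} (\<lambda>u. P u * cpow (real (Suc n) + u) (- s))"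

text \<open>
  This is the integral of \<open>P(x - \<lfloor>x\<rfloor>) x\<^bsup>-s\<^esup>\<close> over \<open>x \<ge> 1\<close>, cut at the integers so that \<open>P\<close> only has to
  be continuous on the closed unit interval, not periodic.
\<close>
definition periodic_mellin :: "(real \<Rightarrow> complex) \<Rightarrow> complex \<Rightarrow> complex" where
  "periodic_mellin P s = (\<Sum>\<^sub>\<infinity>n. unit_term P n s)"

lemma continuous_on_cpow [continuous_intros]:
  assumes "continuous_on A f" "continuous_on A g" "\<And>x. x \<in> A \<Longrightarrow> f x > 0"
  shows "continuous_on A (\<lambda>x. cpow (f x) (g x))"
  unfolding cpow_def using assms by (auto intro!: continuous_intros simp: less_imp_neq[symmetric])

lemma unit_term_integrable:
  assumes "continuous_on {0..1} P"
  shows "(\<lambda>u. P u * cpow (real (Suc n) + u) s) integrable_on {0..1}"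
  by (rule integrable_continuous_real) (auto intro!: continuous_intros assms)

lemma unit_term_holomorphic:
  assumes P: "continuous_on {0..1} P"
  shows "unit_term P n holomorphic_on UNIV"
proof -
  have "(\<lambda>s. integral (cbox 0 1) (\<lambda>u. P u * cpow (real (Suc n) + u) (- s))) holomorphic_on UNIV"
  proof (rule leibniz_rule_holomorphic)
    fix s :: complex and u :: real
    show "((\<lambda>s. P u * cpow (real (Suc n) + u) (- s)) has_field_derivative
        P u * (- of_real (ln (real (Suc n) + u))) * cpow (real (Suc n) + u) (- s)) (at s within UNIV)"
      unfolding cpow_def by (auto intro!: derivative_eq_intros)
    show "(\<lambda>u. P u * cpow (real (Suc n) + u) (- s)) integrable_on cbox 0 1"
      using unit_term_integrable[OF P] by simp
  next
    have "continuous_on (UNIV \<times> cbox 0 1) (\<lambda>p. P (snd p :: real))"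
      by (rule continuous_on_compose2[OF P]) (auto intro!: continuous_intros)
    then show "continuous_on (UNIV \<times> cbox 0 1)
       (\<lambda>(s, u). P u * (- of_real (ln (real (Suc n) + u))) * cpow (real (Suc n) + u) (- s))"
      unfolding case_prod_unfold by (intro continuous_intros) auto
  qed auto
  then show ?thesis
    unfolding unit_term_def by simp
qed

lemma unit_term_bound:
  assumes P: "continuous_on {0..1} P" and B: "\<And>u. u \<in> {0..1} \<Longrightarrow> norm (P u) \<le> B"
    and c: "0 \<le> c" "c \<le> Re s"
  shows "norm (unit_term P n s) \<le> B * real (Suc n) powr (- c)"
proof -
  have "norm (integral {0..1} (\<lambda>u. P u * cpow (real (Suc n) + u) (- s)))
      \<le> B * real (Suc n) powr (- c) * (1 - 0)"
  proof (rule integral_bound)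
    show "continuous_on {0..1} (\<lambda>u. P u * cpow (real (Suc n) + u) (- s))"
      by (auto intro!: continuous_intros P)
    fix u :: real assume u: "u \<in> {0..1}"
    have "norm (cpow (real (Suc n) + u) (- s)) = (real (Suc n) + u) powr (- Re s)"
      using u by (subst norm_cpow) auto
    also have "\<dots> \<le> real (Suc n) powr (- Re s)"
      using u c by (intro powr_mono2') auto
    also have "\<dots> \<le> real (Suc n) powr (- c)"
      using c by (intro powr_mono) auto
    finally show "norm (P u * cpow (real (Suc n) + u) (- s)) \<le> B * real (Suc n) powr (- c)"
      unfolding norm_mult using B[OF u] order.trans[OF norm_ge_zero B[OF u]] by (intro mult_mono) auto
  qed auto
  then show ?thesis
    by (simp add: unit_term_def)
qed

lemma summable_on_Suc_powr:
  assumes "c > 1"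
  shows "(\<lambda>n. real (Suc n) powr (- c)) summable_on UNIV"
proof (rule norm_summable_imp_summable_on)
  have "summable (\<lambda>n. real n powr (- c))"
    using assms by (simp add: summable_real_powr_iff)
  from summable_ignore_initial_segment[OF this, of 1]
  show "summable (\<lambda>n. norm (real (Suc n) powr - c))"
    by simp
qed

lemma continuous_on_unit_bound:
  fixes P :: "real \<Rightarrow> complex"
  assumes P: "continuous_on {0..1} P"
  obtains B where "B \<ge> 0" "\<And>u. u \<in> {0..1} \<Longrightarrow> norm (P u) \<le> B"
proof -
  have "bounded (P ` {0..1})"
    by (intro compact_imp_bounded compact_continuous_image P) auto
  then obtain B where B: "\<And>u. u \<in> {0..1} \<Longrightarrow> norm (P u) \<le> B"
    unfolding bounded_iff by blast
  moreover have "B \<ge> 0"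
    using B[of 0] norm_ge_zero[of "P 0"] by (meson atLeastAtMost_iff order.trans order_refl zero_le_one)
  ultimately show ?thesis using that by blast
qed

lemma unit_term_abs_summable:
  assumes P: "continuous_on {0..1} P" and s: "Re s > 1"
  shows "(\<lambda>n. norm (unit_term P n s)) summable_on UNIV"
proof -
  obtain B where B: "B \<ge> 0" "\<And>u. u \<in> {0..1} \<Longrightarrow> norm (P u) \<le> B"
    using continuous_on_unit_bound[OF P] by blast
  show ?thesis
  proof (rule Infinite_Sum.abs_summable_on_comparison_test')
    show "(\<lambda>n. B * real (Suc n) powr (- Re s)) summable_on UNIV"
      by (intro summable_on_cmult_right summable_on_Suc_powr s)
  qed (use unit_term_bound[OF P B(2)] s in auto)
qed

lemma periodic_mellin_holomorphic:
  assumes P: "continuous_on {0..1} P"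
  shows "periodic_mellin P holomorphic_on {s. Re s > 1}"
proof -
  obtain B where B: "B \<ge> 0" "\<And>u. u \<in> {0..1} \<Longrightarrow> norm (P u) \<le> B"
    using continuous_on_unit_bound[OF P] by blast
  have "(\<lambda>s. \<Sum>\<^sub>\<infinity>n. unit_term P n s) holomorphic_on {s. Re s > 1}"
  proof (rule holomorphic_on_infsum)
    show "open {s. Re s > 1}" by (rule open_halfspace_Re_gt)
    fix z assume z: "z \<in> {s. Re s > 1}"
    define d where "d = (Re z - 1) / 2"
    have d: "d > 0" "1 + d > 1" using z by (auto simp: d_def)
    have re: "Re w \<ge> 1 + d" if "w \<in> cball z d" for w
    proof -
      have "Re z - Re w \<le> d"
        using that complex_Re_le_cmod[of "z - w"] by (auto simp: dist_norm)
      then show ?thesis unfolding d_def by (simp add: field_simps)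
    qed
    show "\<exists>d>0. \<exists>M. cball z d \<subseteq> {s. Re s > 1} \<and> M summable_on UNIV \<and>
        (\<forall>i\<in>UNIV. \<forall>w\<in>cball z d. norm (unit_term P i w) \<le> M i)"
    proof (intro exI[of _ d] conjI exI[of _ "\<lambda>n. B * real (Suc n) powr (- (1 + d))"])
      show "(\<lambda>n. B * real (Suc n) powr (- (1 + d))) summable_on UNIV"
        by (intro summable_on_cmult_right summable_on_Suc_powr d)
      show "cball z d \<subseteq> {s. Re s > 1}" using re d by force
      show "\<forall>i\<in>UNIV. \<forall>w\<in>cball z d. norm (unit_term P i w) \<le> B * real (Suc i) powr - (1 + d)"
      proof (intro ballI)
        fix i w assume "w \<in> cball z d"
        then show "norm (unit_term P i w) \<le> B * real (Suc i) powr - (1 + d)"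
          using d re by (intro unit_term_bound P B) auto
      qed
    qed (use d in auto)
  qed (use unit_term_holomorphic[OF P] holomorphic_on_subset in blast)
  then show ?thesis by (simp add: periodic_mellin_def[abs_def])
qed

lemma periodic_mellin_bound:
  assumes P: "continuous_on {0..1} P"
  shows "\<exists>C\<ge>0. \<forall>s. Re s \<ge> 2 \<longrightarrow> norm (periodic_mellin P s) \<le> C"
proof -
  obtain B where B: "B \<ge> 0" "\<And>u. u \<in> {0..1} \<Longrightarrow> norm (P u) \<le> B"
    using continuous_on_unit_bound[OF P] by blast
  have sm: "(\<lambda>n. B * real (Suc n) powr (- 2)) summable_on UNIV"
    by (intro summable_on_cmult_right summable_on_Suc_powr) auto
  have "norm (periodic_mellin P s) \<le> (\<Sum>\<^sub>\<infinity>n. B * real (Suc n) powr (- 2))" if "Re s \<ge> 2" for s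
    unfolding periodic_mellin_def
  proof (rule norm_infsum_le)
    have "(\<lambda>n. unit_term P n s) summable_on UNIV"
      using unit_term_abs_summable[OF P, of s] that abs_summable_summable by force
    then show "((\<lambda>n. unit_term P n s) has_sum (\<Sum>\<^sub>\<infinity>n. unit_term P n s)) UNIV"
      by simp
    show "((\<lambda>n. B * real (Suc n) powr (- 2)) has_sum (\<Sum>\<^sub>\<infinity>n. B * real (Suc n) powr (- 2))) UNIV"
      using sm by simp
    show "norm (unit_term P n s) \<le> B * real (Suc n) powr - 2" for n
      using unit_term_bound[OF P B(2), of 2 s n] that by simp
  qed
  moreover have "(\<Sum>\<^sub>\<infinity>n. B * real (Suc n) powr (- 2)) \<ge> 0"
    by (intro infsum_nonneg mult_nonneg_nonneg B) auto
  ultimately show ?thesis by blast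
qed

section \<open>Integration by parts and continuation to the left\<close>

lemma cpow_tendsto_0:
  assumes "Re s < 0"
  shows "(\<lambda>n. cpow (real (Suc n)) s) \<longlonglongrightarrow> 0"
proof -
  have "(\<lambda>n. real (Suc n) powr Re s) \<longlonglongrightarrow> 0"
    using filterlim_compose[OF tendsto_neg_powr[OF assms filterlim_real_sequentially] filterlim_Suc] .
  then show ?thesis
    by (subst tendsto_norm_zero_iff[symmetric]) (simp add: norm_cpow)
qed

lemma cpow_shift_has_vector_derivative:
  assumes "c + u > 0"
  shows "((\<lambda>u. cpow (c + u) a) has_vector_derivative a * cpow (c + u) (a - 1)) (at u within A)"
proof -
  have "((\<lambda>u. c + u) has_vector_derivative 1) (at u within A)"
    by (auto intro!: derivative_eq_intros)
  from vector_diff_chain_within[OF this cpow_has_vector_derivative[OF assms]] show ?thesis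
    by (simp add: comp_def)
qed

lemma unit_term_sums:
  assumes "continuous_on {0..1} P" "Re s > 1"
  shows "(\<lambda>n. unit_term P n s) sums periodic_mellin P s"
  unfolding periodic_mellin_def
  by (rule has_sum_imp_sums[OF has_sum_infsum[OF abs_summable_summable[OF unit_term_abs_summable[OF assms]]]])

text \<open>The fundamental theorem applied to Q x^(-s), with x running from n + 1 to n + 2. Since
  \<open>Q 1 = Q 0\<close>, both endpoint terms carry the same coefficient and telescope over
  \<open>n\<close>.\<close>

lemma unit_term_by_parts:
  assumes P: "continuous_on {0..1} P"
    and Q: "\<And>u. u \<in> {0..1} \<Longrightarrow> (Q has_vector_derivative P u) (at u within {0..1})"
    and Q01: "Q 1 = Q 0"
  shows "unit_term P n s = Q 0 * (cpow (real (Suc (Suc n))) (- s) - cpow (real (Suc n)) (- s))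
           + s * unit_term Q n (s + 1)"
proof -
  let ?x = "\<lambda>u. real (Suc n) + u"
  have Qc: "continuous_on {0..1} Q"
    unfolding continuous_on_eq_continuous_within using Q has_vector_derivative_continuous by blast
  have 1: "((\<lambda>u. P u * cpow (?x u) (- s)) has_integral unit_term P n s) {0..1}"
    unfolding unit_term_def by (intro integrable_integral unit_term_integrable P)
  have 2: "((\<lambda>u. s * (Q u * cpow (?x u) (- (s + 1)))) has_integral s * unit_term Q n (s + 1)) {0..1}"
    unfolding unit_term_def by (intro has_integral_mult_right integrable_integral unit_term_integrable Qc)
  have "((\<lambda>u. P u * cpow (?x u) (- s) - s * (Q u * cpow (?x u) (- (s + 1)))) has_integral
      Q 1 * cpow (?x 1) (- s) - Q 0 * cpow (?x 0) (- s)) {0..1}"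
  proof (rule fundamental_theorem_of_calculus)
    fix u :: real assume u: "u \<in> {0..1}"
    have exps: "cpow (?x u) (- (s + 1)) = cpow (?x u) (- s - 1)"
      by simp
    have alg: "q * (- s * a) + p * b = p * b - s * (q * a)" for p q a b :: complex
      by simp
    have "((\<lambda>u. Q u * cpow (?x u) (- s)) has_vector_derivative
        Q u * (- s * cpow (?x u) (- s - 1)) + P u * cpow (?x u) (- s)) (at u within {0..1})"
      by (intro has_vector_derivative_mult cpow_shift_has_vector_derivative Q u) (use u in auto)
    then show "((\<lambda>u. Q u * cpow (?x u) (- s)) has_vector_derivative
        P u * cpow (?x u) (- s) - s * (Q u * cpow (?x u) (- (s + 1)))) (at u within {0..1})"
      by (rule has_vector_derivative_eq_rhs) (simp only: exps alg)
  qed simp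
  from has_integral_unique[OF this has_integral_diff[OF 1 2]]
  show ?thesis
    using Q01 by (simp add: algebra_simps)
qed

text \<open>The endpoint terms telescope to \<open>- Q 0\<close>, because x^(-s) is 1 at x = 1 and
  tends to 0. The transform of \<open>Q\<close> is taken at \<open>s + 1\<close>, so the right-hand
  side makes sense one unit further to the left.\<close>

lemma periodic_mellin_by_parts:
  assumes P: "continuous_on {0..1} P"
    and Q: "\<And>u. u \<in> {0..1} \<Longrightarrow> (Q has_vector_derivative P u) (at u within {0..1})"
    and Q01: "Q 1 = Q 0" and s: "Re s > 1"
  shows "periodic_mellin P s = - Q 0 + s * periodic_mellin Q (s + 1)"
proof -
  have Qc: "continuous_on {0..1} Q"
    unfolding continuous_on_eq_continuous_within using Q has_vector_derivative_continuous by blast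
  have "(\<lambda>n. cpow (real (Suc (Suc n))) (- s) - cpow (real (Suc n)) (- s)) sums
      (0 - cpow (real (Suc 0)) (- s))"
    by (rule telescope_sums[OF cpow_tendsto_0]) (use s in auto)
  then have "(\<lambda>n. Q 0 * (cpow (real (Suc (Suc n))) (- s) - cpow (real (Suc n)) (- s))
      + s * unit_term Q n (s + 1)) sums (Q 0 * (0 - cpow (real (Suc 0)) (- s)) + s * periodic_mellin Q (s + 1))"
    by (intro sums_add sums_mult unit_term_sums Qc) (use s in auto)
  moreover have "unit_term P n s = Q 0 * (cpow (real (Suc (Suc n))) (- s) - cpow (real (Suc n)) (- s))
      + s * unit_term Q n (s + 1)" for n
    by (rule unit_term_by_parts[OF P _ Q01]) (use Q in auto)
  ultimately have "(\<lambda>n. unit_term P n s) sums (- Q 0 + s * periodic_mellin Q (s + 1))"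
    by simp
  with unit_term_sums[OF P s] show ?thesis
    by (rule sums_unique2)
qed

text \<open>Every integration by parts moves the half-plane one unit to the left and costs one
  factor of size \<open>1 + norm s\<close>, whence the exponent \<open>k\<close>. Mean zero of
  \<open>P\<close> is what makes its primitive periodic.\<close>

lemma periodic_mellin_extends:
  assumes "continuous_on {0..1} P" "integral {0..1} P = 0"
  shows "\<exists>E. E holomorphic_on {s. Re s > 1 - real k} \<and> (\<forall>s. Re s > 1 \<longrightarrow> E s = periodic_mellin P s) \<and>
           (\<exists>C\<ge>0. \<forall>s. Re s \<ge> 2 - real k \<longrightarrow> norm (E s) \<le> C * (1 + norm s) ^ k)"
  using assms
proof (induction k arbitrary: P)
  case 0
  then show ?case
    using periodic_mellin_holomorphic[of P] periodic_mellin_bound[of P] by auto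
next
  case (Suc k)
  define Q0 where "Q0 = (\<lambda>u. integral {0..u} P)"
  \<comment> \<open>Subtracting the mean lets the primitive satisfy the hypothesis of the induction
    again.\<close>
  define Q where "Q = (\<lambda>u. Q0 u - integral {0..1} Q0)"
  have Q0: "(Q0 has_vector_derivative P u) (at u within {0..1})" if "u \<in> {0..1}" for u
    unfolding Q0_def by (rule integral_has_vector_derivative) (use Suc that in auto)
  have Q: "(Q has_vector_derivative P u) (at u within {0..1})" if "u \<in> {0..1}" for u
    unfolding Q_def using Q0[OF that] by (auto intro!: derivative_eq_intros)
  have cQ0: "continuous_on {0..1} Q0" and cQ: "continuous_on {0..1} Q"
    unfolding continuous_on_eq_continuous_within using Q0 Q has_vector_derivative_continuous by blast+
  have Q01: "Q 1 = Q 0"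
    using Suc.prems by (simp add: Q_def Q0_def)
  have "integral {0..1} Q = 0"
    unfolding Q_def using integrable_continuous_real[OF cQ0] by (subst integral_diff) auto
  from Suc.IH[OF cQ this] obtain E C where E: "E holomorphic_on {s. Re s > 1 - real k}"
    "\<And>s. Re s > 1 \<Longrightarrow> E s = periodic_mellin Q s" "C \<ge> 0"
    "\<And>s. Re s \<ge> 2 - real k \<Longrightarrow> norm (E s) \<le> C * (1 + norm s) ^ k"
    by blast
  define E' where "E' = (\<lambda>s. - Q 0 + s * E (s + 1))"
  show ?case
  proof (intro exI[of _ E'] conjI allI impI)
    have "(E \<circ> (\<lambda>s. s + 1)) holomorphic_on {s. Re s > 1 - real (Suc k)}"
      by (rule holomorphic_on_compose_gen[OF _ E(1)]) (auto intro!: holomorphic_intros)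
    then show "E' holomorphic_on {s. Re s > 1 - real (Suc k)}"
      unfolding E'_def comp_def by (intro holomorphic_intros)
    show "E' s = periodic_mellin P s" if "Re s > 1" for s
    proof -
      have "periodic_mellin P s = - Q 0 + s * periodic_mellin Q (s + 1)"
        by (rule periodic_mellin_by_parts[OF Suc.prems(1) _ Q01 that]) (use Q in auto)
      then show ?thesis using E(2)[of "s + 1"] that by (simp add: E'_def)
    qed
    have "norm (E' s) \<le> (norm (Q 0) + C * 2 ^ k) * (1 + norm s) ^ Suc k" if "Re s \<ge> 2 - real (Suc k)" for s
    proof -
      have "norm (s + 1) \<le> 1 + norm s"
        using norm_triangle_ineq[of s 1] by simp
      then have "1 + norm (s + 1) \<le> 2 * (1 + norm s)"
        using norm_ge_zero[of s] by argo
      then have "(1 + norm (s + 1)) ^ k \<le> (2 * (1 + norm s)) ^ k"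
        by (intro power_mono) auto
      then have "C * (1 + norm (s + 1)) ^ k \<le> C * (2 * (1 + norm s)) ^ k"
        by (intro mult_left_mono E(3))
      moreover have "norm (E (s + 1)) \<le> C * (1 + norm (s + 1)) ^ k"
        by (rule E(4)) (use that in simp)
      ultimately have "norm (E (s + 1)) \<le> C * (2 * (1 + norm s)) ^ k"
        by (rule order.trans[rotated])
      then have "norm (s * E (s + 1)) \<le> (1 + norm s) * (C * (2 * (1 + norm s)) ^ k)"
        unfolding norm_mult by (intro mult_mono) auto
      moreover have "norm (Q 0) \<le> norm (Q 0) * (1 + norm s) ^ Suc k"
        using one_le_power[of "1 + norm s" "Suc k"] by (intro mult_le_cancel_left1[THEN iffD2]) auto
      moreover have "norm (E' s) \<le> norm (Q 0) + norm (s * E (s + 1))"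
        unfolding E'_def using norm_triangle_ineq[of "- Q 0" "s * E (s + 1)"] by simp
      moreover have "(1 + norm s) * (C * (2 * (1 + norm s)) ^ k) = C * 2 ^ k * (1 + norm s) ^ Suc k"
        by (simp only: power_mult_distrib power_Suc mult_ac)
      ultimately show ?thesis
        unfolding distrib_right by linarith
    qed
    then show "\<exists>C\<ge>0. \<forall>s. Re s \<ge> 2 - real (Suc k) \<longrightarrow> norm (E' s) \<le> C * (1 + norm s) ^ Suc k"
      using E(3) by (intro exI[of _ "norm (Q 0) + C * 2 ^ k"] conjI add_nonneg_nonneg) simp_all
  qed
qed

lemma periodic_mellin_entire_extension:
  assumes P: "continuous_on {0..1} P" "integral {0..1} P = 0"
  obtains E where "E holomorphic_on UNIV" "\<And>s. Re s > 1 \<Longrightarrow> E s = periodic_mellin P s"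
    "\<And>k. \<exists>C\<ge>0. \<forall>s. Re s \<ge> 2 - real k \<longrightarrow> norm (E s) \<le> C * (1 + norm s) ^ k"
proof -
  from periodic_mellin_extends[OF P] obtain E where
    hol: "\<And>k. E k holomorphic_on {s. Re s > 1 - real k}" and
    eq: "\<And>k s. Re s > 1 \<Longrightarrow> E k s = periodic_mellin P s" and
    bd: "\<And>k. \<exists>C\<ge>0. \<forall>s. Re s \<ge> 2 - real k \<longrightarrow> norm (E k s) \<le> C * (1 + norm s) ^ k"
    by metis
  have le: "E j s = E k s" if "j \<le> k" "Re s > 1 - real j" for j k s
  proof (rule analytic_continuation_open[where f = "E j" and g = "E k" and z = s
        and s = "{s. Re s > 1}" and s' = "{s. Re s > 1 - real j}"])
    show "{s. Re s > 1} \<noteq> {}" by (auto intro!: exI[of _ 2])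
    show "E k holomorphic_on {s. Re s > 1 - real j}"
      using hol[of k] by (rule holomorphic_on_subset) (use that in auto)
  qed (use that hol eq in \<open>auto simp: open_halfspace_Re_gt\<close>)
  have agree: "E j s = E k s" if "Re s > 1 - real j" "Re s > 1 - real k" for j k s
    using le[of j k s] le[of k j s] that nat_le_linear[of j k] by metis
  \<comment> \<open>An index whose half-plane contains \<open>s\<close>; taken at
    \<open>z - 1\<close>, its half-plane contains the whole unit disc about
    \<open>z\<close>.\<close>
  define idx where "idx = (\<lambda>s. nat \<lceil>2 - Re s\<rceil>)"
  define F where "F = (\<lambda>s. E (idx s) s)"
  have idx: "Re s > 1 - real (idx s)" for s
    unfolding idx_def by linarith
  have F: "F s = E k s" if "Re s > 1 - real k" for k s
    unfolding F_def by (rule agree[OF idx that])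
  show ?thesis
  proof (rule that[of F])
    have "F analytic_on UNIV"
      unfolding analytic_on_def
    proof
      fix z :: complex
      have re: "Re w > 1 - real (idx (z - 1))" if "w \<in> ball z 1" for w
        using that idx[of "z - 1"] complex_Re_le_cmod[of "z - w"] by (simp add: dist_norm)
      have "E (idx (z - 1)) holomorphic_on ball z 1"
        by (rule holomorphic_on_subset[OF hol]) (use re in auto)
      moreover have "F w = E (idx (z - 1)) w" if "w \<in> ball z 1" for w
        by (rule F[OF re[OF that]])
      ultimately show "\<exists>d>0. F holomorphic_on ball z d"
        using holomorphic_transform[of "E (idx (z - 1))" "ball z 1" F] by (intro exI[of _ 1]) simp
    qed
    then show "F holomorphic_on UNIV" by (rule analytic_imp_holomorphic)
    show "F s = periodic_mellin P s" if "Re s > 1" for s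
      using F[of 0 s] eq that by simp
    show "\<exists>C\<ge>0. \<forall>s. Re s \<ge> 2 - real k \<longrightarrow> norm (F s) \<le> C * (1 + norm s) ^ k" for k
    proof -
      have "F s = E k s" if "Re s \<ge> 2 - real k" for s
        by (rule F) (use that in linarith)
      then show ?thesis using bd[of k] by simp
    qed
  qed
qed

text \<open>Euler-Maclaurin summation of first order for x^(-s). The function
  \<open>u - 1 / 2\<close> is the sawtooth, of mean zero on the unit interval; \<open>1 / 2\<close>
  is the endpoint correction and \<open>1 / (s - 1)\<close> the integral over x \<ge> 1.\<close>

lemma zeta_series_eq_periodic_mellin:
  assumes s: "Re s > 1"
  shows "(\<lambda>n. 1 / (of_nat (Suc n) powr s)) sums
           (1 / 2 + 1 / (s - 1) - s * periodic_mellin (\<lambda>u. of_real u - 1 / 2) (s + 1))"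
proof -
  let ?P = "\<lambda>u. complex_of_real u - 1 / 2"
  let ?y = "\<lambda>n. cpow (real (Suc n)) (- s)" and ?v = "\<lambda>n. cpow (real (Suc n)) (1 - s)"
  have s1: "s \<noteq> 1" using s by auto
  \<comment> \<open>The trapezoidal rule on one unit interval: mean of the endpoint values of x^(-s)
    minus its integral. The antiderivative behind it is (u - 1/2) x^(-s) - x^(1-s) / (1 -
    s).\<close>
  have unit: "- s * unit_term ?P n (s + 1) = (?y (Suc n) + ?y n) / 2 - (?v (Suc n) - ?v n) / (1 - s)" for n
  proof -
    let ?x = "\<lambda>u. real (Suc n) + u"
    have "((\<lambda>u. - s * (?P u * cpow (?x u) (- (s + 1)))) has_integral
        (?P 1 * cpow (?x 1) (- s) - cpow (?x 1) (1 - s) / (1 - s))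
        - (?P 0 * cpow (?x 0) (- s) - cpow (?x 0) (1 - s) / (1 - s))) {0..1}"
    proof (rule fundamental_theorem_of_calculus)
      fix u :: real assume u: "u \<in> {0..1}"
      have exps: "cpow (?x u) (- (s + 1)) = cpow (?x u) (- s - 1)"
        "cpow (?x u) (1 - s - 1) = cpow (?x u) (- s)"
        by simp_all
      have alg: "p * (- s * a) + 1 * b - (1 - s) * b / (1 - s) = - s * (p * a)" for p a b :: complex
        using s1 by simp
      have "(?P has_vector_derivative 1) (at u within {0..1})"
        by (auto intro!: derivative_eq_intros)
      then have "((\<lambda>u. ?P u * cpow (?x u) (- s) - cpow (?x u) (1 - s) / (1 - s)) has_vector_derivative
         (?P u * (- s * cpow (?x u) (- s - 1)) + 1 * cpow (?x u) (- s))
          - (1 - s) * cpow (?x u) (1 - s - 1) / (1 - s)) (at u within {0..1})"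
        by (intro has_vector_derivative_diff has_vector_derivative_mult has_vector_derivative_divide cpow_shift_has_vector_derivative) (use u in auto)
      then show "((\<lambda>u. ?P u * cpow (?x u) (- s) - cpow (?x u) (1 - s) / (1 - s)) has_vector_derivative
          - s * (?P u * cpow (?x u) (- (s + 1)))) (at u within {0..1})"
        by (rule has_vector_derivative_eq_rhs) (simp only: exps alg)
    qed simp
    moreover have "((\<lambda>u. - s * (?P u * cpow (?x u) (- (s + 1)))) has_integral
        - s * unit_term ?P n (s + 1)) {0..1}"
      unfolding unit_term_def
      by (intro has_integral_mult_right integrable_integral unit_term_integrable continuous_intros)
    ultimately have "- s * unit_term ?P n (s + 1) =
        (?P 1 * cpow (?x 1) (- s) - cpow (?x 1) (1 - s) / (1 - s))
        - (?P 0 * cpow (?x 0) (- s) - cpow (?x 0) (1 - s) / (1 - s))"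
      by (rule has_integral_unique[symmetric])
    then show ?thesis
      by (simp add: diff_divide_distrib add_divide_distrib)
  qed
  have "(\<lambda>n. unit_term ?P n (s + 1)) sums periodic_mellin ?P (s + 1)"
    by (rule unit_term_sums) (use s in \<open>auto intro!: continuous_intros\<close>)
  then have "(\<lambda>n. - s * unit_term ?P n (s + 1)) sums (- s * periodic_mellin ?P (s + 1))"
    by (rule sums_mult)
  moreover have "(\<lambda>n. (?v (Suc n) - ?v n) / (1 - s)) sums ((0 - ?v 0) / (1 - s))"
    by (intro sums_divide telescope_sums cpow_tendsto_0) (use s in auto)
  moreover have "(\<lambda>n. (?y (Suc n) - ?y n) / 2) sums ((0 - ?y 0) / 2)"
    by (intro sums_divide telescope_sums cpow_tendsto_0) (use s in auto)
  \<comment> \<open>Adding the integral back and subtracting half the difference of neighbours turns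
    the mean of neighbours into \<open>?y n\<close> alone.\<close>
  ultimately have "(\<lambda>n. - s * unit_term ?P n (s + 1) + (?v (Suc n) - ?v n) / (1 - s) - (?y (Suc n) - ?y n) / 2)
     sums (- s * periodic_mellin ?P (s + 1) + (0 - ?v 0) / (1 - s) - (0 - ?y 0) / 2)"
    by (intro sums_add sums_diff)
  then have "?y sums (- s * periodic_mellin ?P (s + 1) + (0 - ?v 0) / (1 - s) - (0 - ?y 0) / 2)"
    unfolding unit by (simp add: diff_divide_distrib add_divide_distrib)
  moreover have "?y = (\<lambda>n. 1 / (of_nat (Suc n) powr s))"
    unfolding of_nat_powr_eq_cpow[OF zero_less_Suc] by (simp add: cpow_def exp_minus inverse_eq_divide)
  moreover have "- s * periodic_mellin ?P (s + 1) + (0 - ?v 0) / (1 - s) - (0 - ?y 0) / 2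
     = 1 / 2 + 1 / (s - 1) - s * periodic_mellin ?P (s + 1)"
    using s1 by (simp add: divide_simps) (simp add: algebra_simps)
  ultimately show ?thesis by (simp only:)
qed

section \<open>Uniqueness of the continuation and bounds for zeta\<close>

lemma connected_Compl_1: "connected (- {1 :: complex})"
  using connected_open_delete[of "UNIV :: complex set" 1] by (simp add: Compl_eq_Diff_UNIV connected_UNIV)

text \<open>The identity theorem on the connected set \<open>- {1}\<close> leaves only the value at
  \<open>1\<close> free, and \<open>f 1 = 0\<close> fixes that one, so the description in
  \<open>riemann_zeta\<close> is met by exactly one function.\<close>

lemma zeta_extension_unique:
  assumes f: "f holomorphic_on (- {1})" "\<And>s. Re s > 1 \<Longrightarrow> f s = (\<Sum>n. 1 / (of_nat (Suc n) powr s))" "f 1 = 0"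
  shows "riemann_zeta = f"
  unfolding riemann_zeta_def
proof (rule the_equality)
  show "f holomorphic_on - {1} \<and> (\<forall>s. 1 < Re s \<longrightarrow> f s = (\<Sum>n. 1 / of_nat (Suc n) powr s)) \<and> f 1 = 0"
    using f by auto
next
  fix g :: "complex \<Rightarrow> complex"
  assume g: "g holomorphic_on - {1} \<and> (\<forall>s. 1 < Re s \<longrightarrow> g s = (\<Sum>n. 1 / of_nat (Suc n) powr s)) \<and> g 1 = 0"
  have "g s = f s" if "s \<noteq> 1" for s
  proof (rule analytic_continuation_open[where f = g and g = f and s = "{s. Re s > 1}" and s' = "- {1}"])
    show "{s. Re s > 1} \<noteq> {}" by (auto intro!: exI[of _ 2])
  qed (use f g that connected_Compl_1 in \<open>auto simp: open_halfspace_Re_gt\<close>)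
  then show "g = f" using f(3) g by (metis ext)
qed

text \<open>The factor \<open>s - 1\<close> removes the pole, so discs containing \<open>1\<close>
  can be treated like all others. Circles of radius 5 about points with real part 2, used for
  counting zeros, stay in \<open>Re s \<ge> -3\<close>.\<close>

lemma zeta_regularised:
  obtains f C where "f holomorphic_on UNIV" "\<And>s. s \<noteq> 1 \<Longrightarrow> f s = (s - 1) * riemann_zeta s"
    "C \<ge> 1" "\<And>s. Re s \<ge> -3 \<Longrightarrow> norm (f s) \<le> C * (2 + norm s) ^ 6"
    "riemann_zeta holomorphic_on - {1}"
    "\<And>s. Re s > 1 \<Longrightarrow> (\<lambda>n. 1 / (of_nat (Suc n) powr s)) sums riemann_zeta s"
proof -
  have int: "integral {0..1} (\<lambda>u. complex_of_real u - 1 / 2) = 0"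
  proof (rule integral_unique)
    have "((\<lambda>u. complex_of_real u - 1 / 2) has_integral
        (of_real 1 * (of_real 1 - 1) / 2 - of_real 0 * (of_real 0 - 1) / 2)) {0..1}"
      by (rule fundamental_theorem_of_calculus)
         (auto intro!: derivative_eq_intros simp: algebra_simps diff_divide_distrib)
    then show "((\<lambda>u. complex_of_real u - 1 / 2) has_integral 0) {0..1}" by simp
  qed
  have cont: "continuous_on {0..1} (\<lambda>u. complex_of_real u - 1 / 2)"
    by (intro continuous_intros)
  obtain E where E: "E holomorphic_on UNIV"
      "\<And>s. Re s > 1 \<Longrightarrow> E s = periodic_mellin (\<lambda>u. complex_of_real u - 1 / 2) s"
      "\<And>k. \<exists>C\<ge>0. \<forall>s. Re s \<ge> 2 - real k \<longrightarrow> norm (E s) \<le> C * (1 + norm s) ^ k"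
    using periodic_mellin_entire_extension[OF cont int] by metis
  define E1 where "E1 = (\<lambda>s. E (s + 1))"
  have "(E \<circ> (\<lambda>s. s + 1)) holomorphic_on UNIV"
    by (rule holomorphic_on_compose_gen[OF _ E(1)]) (auto intro!: holomorphic_intros)
  then have E1: "E1 holomorphic_on UNIV" by (simp add: E1_def comp_def)
  define Z where "Z = (\<lambda>s. if s = 1 then 0 else 1 / 2 + 1 / (s - 1) - s * E1 s)"
  define f where "f = (\<lambda>s. (s - 1) / 2 + 1 - s * (s - 1) * E1 s)"
  have "(\<lambda>s. 1 / 2 + 1 / (s - 1) - s * E1 s) holomorphic_on - {1}"
    by (intro holomorphic_intros holomorphic_on_subset[OF E1]) auto
  then have Z: "Z holomorphic_on - {1}"
    by (rule holomorphic_transform) (auto simp: Z_def)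
  have ser: "(\<lambda>n. 1 / (of_nat (Suc n) powr s)) sums Z s" if s: "Re s > 1" for s
  proof -
    have "s \<noteq> 1" using s by auto
    then show ?thesis
      using zeta_series_eq_periodic_mellin[OF s] E(2)[of "s + 1"] s by (simp add: Z_def E1_def)
  qed
  have zeta: "riemann_zeta = Z"
    by (rule zeta_extension_unique[OF Z]) (use ser in \<open>auto simp: sums_iff Z_def\<close>)
  \<comment> \<open>\<open>k = 4\<close> because \<open>E\<close> is evaluated at
    \<open>s + 1\<close>, where \<open>Re (s + 1) \<ge> -2\<close>; the factors \<open>s\<close> and
    \<open>s - 1\<close> then raise the exponent from 4 to 6.\<close>
  from E(3)[of 4] obtain C where C: "C \<ge> 0" "\<And>s. Re s \<ge> -2 \<Longrightarrow> norm (E s) \<le> C * (1 + norm s) ^ 4"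
    by auto
  have bound: "norm (f s) \<le> (C + 1) * (2 + norm s) ^ 6" if s: "Re s \<ge> -3" for s
  proof -
    have "norm (E1 s) \<le> C * (1 + norm (s + 1)) ^ 4"
      unfolding E1_def by (rule C) (use s in auto)
    also have "\<dots> \<le> C * (2 + norm s) ^ 4"
      using norm_triangle_ineq[of s 1] by (intro mult_left_mono power_mono C) auto
    finally have 1: "norm (E1 s) \<le> C * (2 + norm s) ^ 4" .
    have n1: "norm (s - 1) \<le> 2 + norm s"
      using norm_triangle_ineq4[of s 1] by simp
    have "norm (s * (s - 1) * E1 s) \<le> (2 + norm s) * (2 + norm s) * (C * (2 + norm s) ^ 4)"
      unfolding norm_mult by (intro mult_mono 1 n1) auto
    then have 2: "norm (s * (s - 1) * E1 s) \<le> C * (2 + norm s) ^ 6"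
      by (simp add: eval_nat_numeral mult_ac)
    have "norm ((s - 1) / 2 + 1) \<le> norm ((s - 1) / 2) + norm (1 :: complex)"
      by (rule norm_triangle_ineq)
    also have "\<dots> \<le> 2 + norm s"
    proof -
      have "norm ((s - 1) / 2) = norm (s - 1) / 2"
        by (simp add: norm_divide)
      moreover have "norm (1 :: complex) = 1" by simp
      ultimately show ?thesis using n1 norm_ge_zero[of s] by linarith
    qed
    also have "\<dots> \<le> (2 + norm s) ^ 6"
      by (rule self_le_power) auto
    finally have 3: "norm ((s - 1) / 2 + 1) \<le> (2 + norm s) ^ 6" .
    show ?thesis
      unfolding f_def using norm_triangle_ineq4[of "(s - 1) / 2 + 1" "s * (s - 1) * E1 s"] 2 3
      by (simp add: algebra_simps)
  qed
  show ?thesis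
  proof (rule that[of f "C + 1"])
    show "f holomorphic_on UNIV"
      unfolding f_def by (intro holomorphic_intros E1) auto
    show "f s = (s - 1) * riemann_zeta s" if "s \<noteq> 1" for s
      using that by (simp add: f_def zeta Z_def field_simps)
  qed (use C bound Z ser zeta in auto)
qed

text \<open>The series without its first term is dominated by its values at \<open>2\<close>, that
  is by \<open>pi^2 / 6 - 1\<close>. The bound is uniform in the height, which makes the points 2 +
  iT good centres for counting zeros.\<close>

lemma zeta_lower_bound:
  assumes "Re s = 2"
  shows "norm (riemann_zeta s) \<ge> 1 / 3"
proof -
  have ser: "(\<lambda>n. 1 / (of_nat (Suc n) powr s)) sums riemann_zeta s"
  proof (rule zeta_regularised)
    assume "\<And>s. Re s > 1 \<Longrightarrow> (\<lambda>n. 1 / (of_nat (Suc n) powr s)) sums riemann_zeta s"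
    then show ?thesis using assms by simp
  qed
  have tail: "(\<lambda>n. 1 / (of_nat (Suc (Suc n)) powr s)) sums (riemann_zeta s - 1)"
    using ser by (subst sums_Suc_iff) simp
  have sq: "(\<lambda>n. 1 / (real (Suc (Suc n)))\<^sup>2) sums (pi\<^sup>2 / 6 - 1)"
    using inverse_squares_sums by (subst sums_Suc_iff) (simp add: add_ac)
  have nrm: "norm (1 / (of_nat (Suc (Suc n)) powr s)) = 1 / (real (Suc (Suc n)))\<^sup>2" for n
  proof -
    have "norm (of_nat (Suc (Suc n)) powr s) = real (Suc (Suc n)) powr 2"
      by (subst norm_powr_real_powr) (use assms in auto)
    then show ?thesis by (simp add: norm_divide powr_numeral)
  qed
  have "norm (riemann_zeta s - 1) \<le> pi\<^sup>2 / 6 - 1"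
    using summable_norm[of "\<lambda>n. 1 / (of_nat (Suc (Suc n)) powr s)"] tail sq
    unfolding nrm by (simp add: sums_iff)
  also have "\<dots> \<le> 2 / 3"
  proof -
    \<comment> \<open>\<open>3.16^2 < 10\<close>, and \<open>pi^2 \<le> 10\<close> is what the bound
      \<open>2 / 3\<close> asks for.\<close>
    have "pi\<^sup>2 \<le> (316 / 100)\<^sup>2"
      by (rule power_mono) (use pi_approx in auto)
    then show ?thesis by (simp add: power2_eq_square)
  qed
  finally show ?thesis
    using norm_triangle_ineq2[of 1 "1 - riemann_zeta s"] by (simp add: norm_minus_commute)
qed

section \<open>Counting zeros\<close>

text \<open>Zeros are divided out one point at a time with full multiplicity. The orders stay those
  of the original \<open>f\<close>, since the factors belonging to other points do not vanish at
  \<open>w\<close>.\<close>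

lemma holomorphic_factor_zeros:
  assumes f: "f holomorphic_on S" and S: "open S" "connected S" and nz: "\<exists>z\<in>S. f z \<noteq> 0"
    and Z: "finite Z" "Z \<subseteq> S"
  shows "\<exists>g. g holomorphic_on S \<and> (\<forall>z\<in>S. f z = g z * (\<Prod>w\<in>Z. (z - w) ^ nat (zorder f w)))"
  using Z
proof (induction Z rule: finite_induct)
  case empty
  then show ?case using f by auto
next
  case (insert w Z)
  then obtain g where g: "g holomorphic_on S"
    and fg: "\<And>z. z \<in> S \<Longrightarrow> f z = g z * (\<Prod>w\<in>Z. (z - w) ^ nat (zorder f w))"
    by auto
  define P where "P = (\<lambda>z. \<Prod>w\<in>Z. (z - w) ^ nat (zorder f w))"
  have w: "w \<in> S" using insert by auto
  have "\<exists>z\<in>S. g z \<noteq> 0" using nz fg by auto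
  note zorder_g = zorder_exist_zero[OF g S w this]
  have n0: "zorder g w \<ge> 0"
    using conjunct1[OF zorder_g] by (simp split: if_splits)
  from conjunct2[OF zorder_g] obtain r where r: "r > 0" "cball w r \<subseteq> S" "zor_poly g w holomorphic_on cball w r"
    and zp: "\<And>z. z \<in> cball w r \<Longrightarrow> g z = zor_poly g w z * (z - w) ^ nat (zorder g w) \<and> zor_poly g w z \<noteq> 0"
    by blast
  have P: "P holomorphic_on UNIV" unfolding P_def by (intro holomorphic_intros)
  have Pw: "P w \<noteq> 0" unfolding P_def using insert by auto
  have hb: "zor_poly g w holomorphic_on ball w r"
    using r(3) ball_subset_cball by (rule holomorphic_on_subset)
  have ord: "zorder f w = zorder g w"
  proof (rule zorder_eqI[of "ball w r" _ "\<lambda>z. zor_poly g w z * P z"])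
    show "(\<lambda>z. zor_poly g w z * P z) holomorphic_on ball w r"
      by (intro holomorphic_intros hb holomorphic_on_subset[OF P]) auto
    show "zor_poly g w w * P w \<noteq> 0" using Pw zp[of w] r by auto
    fix z assume z: "z \<in> ball w r" "z \<noteq> w"
    then have "z \<in> cball w r" by auto
    with zp[OF this] fg[of z] r n0 show "f z = zor_poly g w z * P z * (z - w) powi zorder g w"
      by (auto simp: P_def power_int_def)
  qed (use r in auto)
  \<comment> \<open>The quotient of \<open>g\<close> by the power of \<open>z - w\<close>, with its
    removable singularity filled in by \<open>zor_poly\<close>.\<close>
  define h where "h = (\<lambda>z. if z \<in> ball w r then zor_poly g w z else g z / (z - w) ^ nat (zorder f w))"
  have gh: "g z = h z * (z - w) ^ nat (zorder f w)" if "z \<in> S" for z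
    using zp[of z] r(1) by (auto simp: h_def ord)
  have h_off: "h z = g z / (z - w) ^ nat (zorder f w)" if "z \<in> S" "z \<noteq> w" for z
    using gh[OF that(1)] that(2) by simp
  have "h holomorphic_on ball w r"
    using hb by (rule holomorphic_transform) (auto simp: h_def)
  moreover have "(\<lambda>z. g z / (z - w) ^ nat (zorder f w)) holomorphic_on S - {w}"
    by (intro holomorphic_intros holomorphic_on_subset[OF g]) auto
  then have "h holomorphic_on S - {w}"
    by (rule holomorphic_transform) (use h_off in auto)
  ultimately have "h holomorphic_on (ball w r \<union> (S - {w}))"
    by (rule holomorphic_on_Un) (use S in auto)
  then have "h holomorphic_on S"
    by (rule holomorphic_on_subset) (use r in auto)
  moreover have "f z = h z * (\<Prod>w\<in>insert w Z. (z - w) ^ nat (zorder f w))" if "z \<in> S" for z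
    using fg[OF that] gh[OF that] insert by simp
  ultimately show ?case by blast
qed

text \<open>A coarse form of Jensen's inequality. Each divided-out factor has modulus at least
  \<open>R - r\<close> on the circle of radius \<open>R\<close> and at most \<open>r\<close> at the
  centre; the maximum principle for the quotient compares the two. The number of zeros is limited
  once \<open>R > 2 * r\<close>.\<close>

lemma zero_count_bound:
  assumes f: "f holomorphic_on UNIV" and fc: "f c \<noteq> 0"
    and rR: "0 < r" "r < R"
    and M: "\<And>z. dist c z = R \<Longrightarrow> norm (f z) \<le> M"
    and Z: "finite Z" "Z \<subseteq> cball c r"
  shows "norm (f c) * ((R - r) / r) ^ (\<Sum>w\<in>Z. nat (zorder f w)) \<le> M"
proof -
  obtain g where g: "g holomorphic_on UNIV"
    and fg: "\<And>z. f z = g z * (\<Prod>w\<in>Z. (z - w) ^ nat (zorder f w))"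
    using holomorphic_factor_zeros[OF f _ _ _ Z(1)] fc by auto
  define N where "N = (\<Sum>w\<in>Z. nat (zorder f w))"
  have lower: "(R - r) ^ N \<le> norm (\<Prod>w\<in>Z. (z - w) ^ nat (zorder f w))" if "dist c z = R" for z
    unfolding N_def power_sum prod_norm[symmetric] norm_power
  proof (intro prod_mono conjI power_mono)
    fix w assume "w \<in> Z"
    then have "dist c w \<le> r" using Z by auto
    then show "R - r \<le> norm (z - w)"
      using that dist_triangle[of c z w] by (simp add: dist_norm norm_minus_commute)
  qed (use rR in auto)
  have upper: "norm (\<Prod>w\<in>Z. (c - w) ^ nat (zorder f w)) \<le> r ^ N"
    unfolding N_def power_sum prod_norm[symmetric] norm_power
    by (intro prod_mono conjI power_mono) (use Z in \<open>auto simp: dist_norm\<close>)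
  have "norm (g c) \<le> M / (R - r) ^ N"
  proof (rule maximum_modulus_frontier[of g "cball c R"])
    fix z assume "z \<in> frontier (cball c R)"
    then have z: "dist c z = R" using rR by (simp add: frontier_cball sphere_def)
    have "norm (g z) * (R - r) ^ N \<le> norm (g z) * norm (\<Prod>w\<in>Z. (z - w) ^ nat (zorder f w))"
      by (intro mult_left_mono lower z) auto
    also have "\<dots> = norm (f z)" by (simp add: fg[of z] norm_mult)
    also have "\<dots> \<le> M" by (rule M[OF z])
    finally show "norm (g z) \<le> M / (R - r) ^ N"
      using rR by (simp add: pos_le_divide_eq)
  qed (use g rR in \<open>auto intro: holomorphic_on_subset holomorphic_on_imp_continuous_on\<close>)
  then have "norm (g c) * r ^ N \<le> M / (R - r) ^ N * r ^ N"
    using rR by (intro mult_right_mono) auto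
  moreover have "norm (f c) \<le> norm (g c) * r ^ N"
    unfolding fg[of c] norm_mult by (intro mult_left_mono upper) auto
  ultimately have "norm (f c) \<le> M / (R - r) ^ N * r ^ N" by linarith
  then show ?thesis
    using rR unfolding N_def[symmetric] by (simp add: power_divide field_simps)
qed

section \<open>Zeros of zeta near a given height, with multiplicity\<close>

lemma zeta_holomorphic: "riemann_zeta holomorphic_on - {1}"
  by (rule zeta_regularised)

lemma zeta_nonzero_2: "riemann_zeta 2 \<noteq> 0"
  using zeta_lower_bound[of 2] by auto

lemma zorder_zeta_pos:
  assumes "\<rho> \<in> nontrivial_zeros"
  shows "zorder riemann_zeta \<rho> > 0"
proof -
  have "\<rho> \<in> - {1}" "riemann_zeta \<rho> = 0"
    using assms by (auto simp: nontrivial_zeros_def)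
  moreover have "\<exists>w\<in>- {1}. riemann_zeta w \<noteq> 0"
    using zeta_nonzero_2 by (intro bexI[of _ 2]) auto
  ultimately show ?thesis
    using zorder_exist_zero[OF zeta_holomorphic _ connected_Compl_1, of \<rho>] by (simp add: open_Compl)
qed

text \<open>This transfers multiplicities between zeta and its regularisation by the factor
  \<open>s - 1\<close>.\<close>

lemma zorder_mult_nonzero:
  assumes f: "f holomorphic_on S" and S: "open S" "connected S" "z \<in> S" and nz: "\<exists>w\<in>S. f w \<noteq> 0"
    and h: "h holomorphic_on S" "h z \<noteq> 0" and F: "\<And>w. w \<in> S \<Longrightarrow> F w = h w * f w"
  shows "zorder F z = zorder f z"
proof -
  note zorder_f = zorder_exist_zero[OF f S nz]
  have n0: "zorder f z \<ge> 0"
    using conjunct1[OF zorder_f] by (simp split: if_splits)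
  from conjunct2[OF zorder_f] obtain r where r: "r > 0" "cball z r \<subseteq> S" "zor_poly f z holomorphic_on cball z r"
    and zp: "\<And>w. w \<in> cball z r \<Longrightarrow> f w = zor_poly f z w * (w - z) ^ nat (zorder f z) \<and> zor_poly f z w \<noteq> 0"
    by blast
  show ?thesis
  proof (rule zorder_eqI[of "ball z r" _ "\<lambda>w. h w * zor_poly f z w"])
    show "(\<lambda>w. h w * zor_poly f z w) holomorphic_on ball z r"
      using r by (intro holomorphic_intros holomorphic_on_subset[OF h(1)] holomorphic_on_subset[OF r(3)]) auto
    show "h z * zor_poly f z z \<noteq> 0" using h(2) zp[of z] r by auto
    fix w assume w: "w \<in> ball z r" "w \<noteq> z"
    then have "w \<in> cball z r" by auto
    with zp[OF this] F[of w] r n0 show "F w = h w * zor_poly f z w * (w - z) powi zorder f z"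
      by (auto simp: power_int_def)
  qed (use r in auto)
qed

text \<open>The disc of radius 9/4 about 2 + iT covers the window of height 1 on both sides of T in
  the strip, because 2^2 + 1^2 < (9/4)^2. With outer radius 5 the ratio \<open>(R - r) / r\<close>
  is \<open>11 / 9 > 1\<close>, and logarithms give the count.\<close>

lemma nontrivial_zeros_count:
  obtains A where "A \<ge> 0"
    "\<And>T Z. finite Z \<Longrightarrow> Z \<subseteq> nontrivial_zeros \<Longrightarrow> (\<And>\<rho>. \<rho> \<in> Z \<Longrightarrow> \<bar>Im \<rho> - T\<bar> \<le> 1) \<Longrightarrow>
       real (\<Sum>\<rho>\<in>Z. nat (zorder riemann_zeta \<rho>)) \<le> A * sqrt (9 + \<bar>T\<bar>)"
proof (rule zeta_regularised)
  fix f C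
  assume f: "f holomorphic_on UNIV" "\<And>s. s \<noteq> 1 \<Longrightarrow> f s = (s - 1) * riemann_zeta s"
    and C: "C \<ge> 1" "\<And>s. Re s \<ge> -3 \<Longrightarrow> norm (f s) \<le> C * (2 + norm s) ^ 6"
  \<comment> \<open>The 3 comes from the lower bound 1/3 at the centre; 12 is the exponent 6 times
    the 2 in ln x \<le> 2 sqrt x.\<close>
  define A where "A = (ln (3 * C) + 12) / ln (11 / 9)"
  have lnC: "ln (3 * C) \<ge> 0" using C by simp
  show ?thesis
  proof (rule that[of A])
    show "A \<ge> 0" using lnC by (simp add: A_def)
    fix T :: real and Z
    assume Z: "finite Z" "Z \<subseteq> nontrivial_zeros" "\<And>\<rho>. \<rho> \<in> Z \<Longrightarrow> \<bar>Im \<rho> - T\<bar> \<le> 1"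
    define c where "c = Complex 2 T"
    \<comment> \<open>On the circle \<open>norm z \<le> norm c + 5 \<le> 7 + \<bar>T\<bar>\<close>,
      so \<open>x\<close> dominates \<open>2 + norm z\<close>.\<close>
    define x where "x = 9 + \<bar>T\<bar>"
    define N where "N = (\<Sum>\<rho>\<in>Z. nat (zorder f \<rho>))"
    have x: "x \<ge> 9" by (simp add: x_def)
    have fc: "norm (f c) \<ge> 1 / 3"
    proof -
      have "1 \<le> norm (c - 1)"
        using complex_Re_le_cmod[of "c - 1"] by (simp add: c_def)
      moreover have "c \<noteq> 1" by (auto simp: c_def complex_eq_iff)
      moreover have "1 / 3 \<le> norm (riemann_zeta c)"
        by (rule zeta_lower_bound) (simp add: c_def)
      ultimately show ?thesis
        using mult_mono[of 1 "norm (c - 1)" "1 / 3" "norm (riemann_zeta c)"] by (simp add: f norm_mult)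
    qed
    have upper: "norm (f z) \<le> C * x ^ 6" if z: "dist c z = 5" for z
    proof -
      have "Re c - Re z \<le> 5"
        using complex_Re_le_cmod[of "c - z"] z by (simp add: dist_norm)
      then have "norm (f z) \<le> C * (2 + norm z) ^ 6"
        by (intro C) (simp add: c_def)
      also have "norm z \<le> norm c + 5"
        using z norm_triangle_sub[of z c] by (simp add: dist_norm norm_minus_commute)
      moreover have "norm c \<le> 2 + \<bar>T\<bar>"
        using cmod_le[of c] by (simp add: c_def)
      ultimately show ?thesis
        using C unfolding x_def
        by (elim order.trans) (intro mult_left_mono power_mono, auto)
    qed
    have sub: "Z \<subseteq> cball c (9 / 4)"
    proof
      fix \<rho> assume \<rho>: "\<rho> \<in> Z"
      then have re: "0 < Re \<rho>" "Re \<rho> < 1" using Z by (auto simp: nontrivial_zeros_def)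
      have "(2 - Re \<rho>)\<^sup>2 \<le> 2\<^sup>2" by (rule power_mono) (use re in auto)
      moreover have "(T - Im \<rho>)\<^sup>2 \<le> 1"
        using Z(3)[OF \<rho>] by (simp add: abs_square_le_1 abs_minus_commute)
      ultimately have "(2 - Re \<rho>)\<^sup>2 + (T - Im \<rho>)\<^sup>2 \<le> (9 / 4)\<^sup>2"
        by (simp add: power2_eq_square)
      then have "sqrt ((2 - Re \<rho>)\<^sup>2 + (T - Im \<rho>)\<^sup>2) \<le> 9 / 4"
        by (intro real_le_lsqrt) auto
      then show "\<rho> \<in> cball c (9 / 4)"
        by (simp add: dist_norm cmod_def c_def)
    qed
    have "f c \<noteq> 0" using fc by auto
    from zero_count_bound[where R = 5, OF f(1) this _ _ upper Z(1) sub]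
    have "norm (f c) * (11 / 9) ^ N \<le> C * x ^ 6" by (simp add: N_def)
    moreover have "1 / 3 * (11 / 9) ^ N \<le> norm (f c) * (11 / 9 :: real) ^ N"
      by (intro mult_right_mono fc) auto
    ultimately have "1 / 3 * (11 / 9) ^ N \<le> C * x ^ 6" by (rule order.trans[rotated])
    then have "(11 / 9) ^ N \<le> 3 * C * x ^ 6" by simp
    then have "ln ((11 / 9) ^ N) \<le> ln (3 * C * x ^ 6)"
      by (intro ln_mono) auto
    then have "real N * ln (11 / 9) \<le> ln (3 * C) + 6 * ln x"
      using C x by (simp add: ln_realpow ln_mult)
    also have "\<dots> \<le> ln (3 * C) * sqrt x + 12 * sqrt x"
    proof -
      have "ln x = 2 * ln (sqrt x)" using x by (simp add: ln_sqrt)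
      moreover have "ln (sqrt x) \<le> sqrt x - 1" by (rule ln_le_minus_one) (use x in auto)
      moreover have "ln (3 * C) * 1 \<le> ln (3 * C) * sqrt x"
        by (intro mult_left_mono lnC) (use x in auto)
      ultimately show ?thesis by linarith
    qed
    finally have "real N \<le> A * sqrt x"
      by (simp add: A_def field_simps)
    moreover have "zorder f \<rho> = zorder riemann_zeta \<rho>" if "\<rho> \<in> Z" for \<rho>
    proof (rule zorder_mult_nonzero[OF zeta_holomorphic _ connected_Compl_1])
      show "\<rho> \<in> - {1}" using that Z by (auto simp: nontrivial_zeros_def)
      then show "\<rho> - 1 \<noteq> 0" by auto
      show "\<exists>w\<in>- {1}. riemann_zeta w \<noteq> 0"
        using zeta_nonzero_2 by (intro bexI[of _ 2]) auto
    qed (use f in \<open>auto intro!: holomorphic_intros\<close>)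
    ultimately show "real (\<Sum>\<rho>\<in>Z. nat (zorder riemann_zeta \<rho>)) \<le> A * sqrt (9 + \<bar>T\<bar>)"
      by (simp add: N_def x_def)
  qed
qed

section \<open>Absolute convergence of the sum over zeros\<close>

definition zero_weight :: "complex \<Rightarrow> complex" where
  "zero_weight \<rho> = of_int (zorder riemann_zeta \<rho>) / (\<rho> * (1 - \<rho>))"

lemma norm_zero_weight:
  assumes "\<rho> \<in> nontrivial_zeros"
  shows "norm (zero_weight \<rho>) = real (nat (zorder riemann_zeta \<rho>)) / (norm \<rho> * norm (1 - \<rho>))"
  using zorder_zeta_pos[OF assms] by (simp add: zero_weight_def norm_divide norm_mult)

text \<open>Zeros are grouped by the integer part of \<open>\<bar>Im \<rho>\<bar>\<close>. Group n
  contains O(n^(1/2)) zeros with multiplicity, each contributing at most 1/n^2, so its total is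
  O(n^(-3/2)).\<close>

lemma zero_weight_summable: "(\<lambda>\<rho>. norm (zero_weight \<rho>)) summable_on nontrivial_zeros"
proof -
  obtain A where A: "A \<ge> 0"
    "\<And>T Z. finite Z \<Longrightarrow> Z \<subseteq> nontrivial_zeros \<Longrightarrow> (\<And>\<rho>. \<rho> \<in> Z \<Longrightarrow> \<bar>Im \<rho> - T\<bar> \<le> 1) \<Longrightarrow>
       real (\<Sum>\<rho>\<in>Z. nat (zorder riemann_zeta \<rho>)) \<le> A * sqrt (9 + \<bar>T\<bar>)"
    using nontrivial_zeros_count by metis
  define mult where "mult = (\<lambda>\<rho>. nat (zorder riemann_zeta \<rho>))"
  define W where "W = (\<lambda>n. {\<rho>\<in>nontrivial_zeros. nat \<lfloor>\<bar>Im \<rho>\<bar>\<rfloor> = n})"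
  have W_im: "real n \<le> \<bar>Im \<rho>\<bar>" "\<bar>Im \<rho>\<bar> \<le> real n + 1" if "\<rho> \<in> W n" for \<rho> n
    using that unfolding W_def by (auto simp: nat_eq_iff floor_eq_iff)
  \<comment> \<open>Heights near \<open>n\<close> and near \<open>- n\<close> are counted
    separately, hence the factor 2.\<close>
  have count: "real (sum mult Z) \<le> 2 * A * sqrt (9 + real n)" if Z: "finite Z" "Z \<subseteq> W n" for Z n
  proof -
    define Z1 where "Z1 = {\<rho>\<in>Z. Im \<rho> \<ge> 0}"
    define Z2 where "Z2 = {\<rho>\<in>Z. Im \<rho> < 0}"
    have "real (sum mult Z1) \<le> A * sqrt (9 + \<bar>real n\<bar>)"
      unfolding mult_def
    proof (rule A(2))
      fix \<rho> assume "\<rho> \<in> Z1"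
      then have "\<rho> \<in> W n" "Im \<rho> \<ge> 0" using Z by (auto simp: Z1_def)
      with W_im[of \<rho> n] show "\<bar>Im \<rho> - real n\<bar> \<le> 1" by simp
    qed (use Z in \<open>auto simp: Z1_def W_def\<close>)
    moreover have "real (sum mult Z2) \<le> A * sqrt (9 + \<bar>- real n\<bar>)"
      unfolding mult_def
    proof (rule A(2))
      fix \<rho> assume "\<rho> \<in> Z2"
      then have "\<rho> \<in> W n" "Im \<rho> < 0" using Z by (auto simp: Z2_def)
      with W_im[of \<rho> n] show "\<bar>Im \<rho> - - real n\<bar> \<le> 1" by simp
    qed (use Z in \<open>auto simp: Z2_def W_def\<close>)
    moreover have "sum mult Z = sum mult Z1 + sum mult Z2"
    proof -
      have "Z1 \<union> Z2 = Z" by (auto simp: Z1_def Z2_def)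
      moreover have "sum mult (Z1 \<union> Z2) = sum mult Z1 + sum mult Z2"
        by (rule sum.union_disjoint) (use Z in \<open>auto simp: Z1_def Z2_def\<close>)
      ultimately show ?thesis by simp
    qed
    ultimately show ?thesis by simp
  qed
  \<comment> \<open>Every zero has multiplicity at least 1, so \<open>count\<close> bounds the
    cardinality of all finite subsets of the group, which forces the group to be finite.\<close>
  have finW: "finite (W n)" for n
  proof -
    have "card G \<le> nat \<lfloor>2 * A * sqrt (9 + real n)\<rfloor>" if "G \<subseteq> W n" "finite G" for G
    proof -
      have "card G \<le> sum mult G"
        unfolding card_eq_sum
      proof (rule sum_mono)
        fix \<rho> assume "\<rho> \<in> G"
        then show "1 \<le> mult \<rho>" using that zorder_zeta_pos[of \<rho>] by (auto simp: mult_def W_def)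
      qed
      then have "real (card G) \<le> 2 * A * sqrt (9 + real n)"
        using count[OF that(2,1)] by linarith
      then show ?thesis by (simp add: le_nat_floor)
    qed
    from finite_if_finite_subsets_card_bdd[OF this] show ?thesis by blast
  qed
  define b where "b = (\<lambda>n. \<Sum>\<rho>\<in>W n. norm (zero_weight \<rho>))"
  have b_nonneg: "b n \<ge> 0" for n unfolding b_def by (intro sum_nonneg) auto
  \<comment> \<open>Group 0 is left out because weights are compared with \<open>1 / n^2\<close>;
    one term does not affect summability. The constant 8 is \<open>2 * sqrt 16\<close>, from
    \<open>9 + n \<le> 16 * n\<close>.\<close>
  have b_le: "b n \<le> 8 * A * real n powr (- (3 / 2))" if n: "n \<ge> 1" for n
  proof -
    have "norm (zero_weight \<rho>) \<le> real (mult \<rho>) / (real n)\<^sup>2" if \<rho>: "\<rho> \<in> W n" for \<rho>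
    proof -
      have "real n \<le> norm \<rho>" "real n \<le> norm (1 - \<rho>)"
        using W_im(1)[OF \<rho>] abs_Im_le_cmod[of \<rho>] abs_Im_le_cmod[of "1 - \<rho>"] by auto
      then have "(real n)\<^sup>2 \<le> norm \<rho> * norm (1 - \<rho>)"
        unfolding power2_eq_square by (intro mult_mono) auto
      moreover have "norm (zero_weight \<rho>) = real (mult \<rho>) / (norm \<rho> * norm (1 - \<rho>))"
        using \<rho> by (simp add: norm_zero_weight W_def mult_def)
      moreover have "(real n)\<^sup>2 > 0" using n by simp
      ultimately show ?thesis by (simp add: frac_le)
    qed
    then have "b n \<le> (\<Sum>\<rho>\<in>W n. real (mult \<rho>) / (real n)\<^sup>2)"
      unfolding b_def by (intro sum_mono)
    also have "\<dots> = real (sum mult (W n)) / (real n)\<^sup>2"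
      by (simp add: sum_divide_distrib)
    also have "\<dots> \<le> 2 * A * sqrt (9 + real n) / (real n)\<^sup>2"
      by (intro divide_right_mono count finW) auto
    also have "sqrt (9 + real n) \<le> sqrt (16 * real n)"
      using n by (intro real_sqrt_le_mono) auto
    then have "2 * A * sqrt (9 + real n) / (real n)\<^sup>2 \<le> 2 * A * sqrt (16 * real n) / (real n)\<^sup>2"
      by (intro divide_right_mono mult_left_mono) (use A in auto)
    also have "\<dots> = 8 * A * (real n powr (1 / 2) / real n powr 2)"
      using n by (simp add: real_sqrt_mult powr_half_sqrt powr_numeral)
    also have "\<dots> = 8 * A * real n powr (- (3 / 2))"
    proof -
      have "real n powr (1 / 2) / real n powr 2 = real n powr (- (3 / 2))"
        by (subst powr_diff[symmetric]) simp
      then show ?thesis by (simp only:)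
    qed
    finally show ?thesis .
  qed
  have sb: "summable b"
  proof (rule summable_comparison_test_ev)
    show "\<forall>\<^sub>F n in sequentially. norm (b n) \<le> 8 * A * real n powr (- (3 / 2))"
      using eventually_ge_at_top[of 1] by eventually_elim (use b_le b_nonneg in auto)
    show "summable (\<lambda>n. 8 * A * real n powr (- (3 / 2)))"
      by (intro summable_mult) (simp add: summable_real_powr_iff)
  qed
  show ?thesis
  proof (rule nonneg_bdd_above_summable_on)
    have "sum (\<lambda>\<rho>. norm (zero_weight \<rho>)) F \<le> suminf b" if F: "F \<subseteq> nontrivial_zeros" "finite F" for F
    proof -
      define I where "I = (\<lambda>\<rho>. nat \<lfloor>\<bar>Im \<rho>\<bar>\<rfloor>) ` F"
      have I: "finite I" using F by (simp add: I_def)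
      have "sum (\<lambda>\<rho>. norm (zero_weight \<rho>)) F \<le> sum (\<lambda>\<rho>. norm (zero_weight \<rho>)) (\<Union>n\<in>I. W n)"
        using F I finW by (intro sum_mono2) (auto simp: I_def W_def)
      also have "\<dots> = (\<Sum>n\<in>I. b n)"
        unfolding b_def using I finW by (intro sum.UNION_disjoint) (auto simp: W_def)
      also have "\<dots> \<le> suminf b"
        by (intro sum_le_suminf sb I) (use b_nonneg in auto)
      finally show ?thesis .
    qed
    then show "bdd_above (sum (\<lambda>\<rho>. norm (zero_weight \<rho>)) ` {F. F \<subseteq> nontrivial_zeros \<and> finite F})"
      by (intro bdd_aboveI2[of _ _ "suminf b"]) auto
  qed auto
qed

section \<open>The screw function under the Riemann hypothesis\<close>

lemma norm_exp_zero_le: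
  assumes "\<rho> \<in> nontrivial_zeros"
  shows "norm (exp ((\<rho> - 1 / 2) * of_real t)) \<le> exp (\<bar>t\<bar> / 2)"
proof -
  have "\<bar>Re \<rho> - 1 / 2\<bar> \<le> 1 / 2"
    unfolding abs_le_iff using assms by (auto simp: nontrivial_zeros_def)
  then have "\<bar>Re \<rho> - 1 / 2\<bar> * \<bar>t\<bar> \<le> 1 / 2 * \<bar>t\<bar>"
    by (intro mult_right_mono) auto
  then have "(Re \<rho> - 1 / 2) * t \<le> \<bar>t\<bar> / 2"
    using abs_ge_self[of "(Re \<rho> - 1 / 2) * t"] by (simp add: abs_mult)
  then show ?thesis by simp
qed

lemma H1_exp:
  "H1 (exp t) = (\<Sum>\<^sub>\<infinity>\<rho>\<in>nontrivial_zeros. zero_weight \<rho> * exp ((\<rho> - 1 / 2) * of_real t))"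
  unfolding H1_def
proof (rule infsum_cong)
  fix \<rho>
  have "complex_of_real (exp t) powr (\<rho> - 1 / 2) = exp ((\<rho> - 1 / 2) * of_real t)"
    by (simp add: powr_def Ln_of_real del: exp_of_real flip: exp_of_real)
  then show "of_int (zorder riemann_zeta \<rho>) * (complex_of_real (exp t) powr (\<rho> - 1 / 2) / (\<rho> * (1 - \<rho>)))
      = zero_weight \<rho> * exp ((\<rho> - 1 / 2) * of_real t)"
    by (simp add: zero_weight_def)
qed

lemma zero_weight_exp_bound:
  assumes "\<rho> \<in> nontrivial_zeros" "\<bar>t\<bar> \<le> T"
  shows "norm (zero_weight \<rho> * exp ((\<rho> - 1 / 2) * of_real t)) \<le> norm (zero_weight \<rho>) * exp (T / 2)"
proof -
  have "norm (exp ((\<rho> - 1 / 2) * of_real t)) \<le> exp (\<bar>t\<bar> / 2)"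
    by (rule norm_exp_zero_le[OF assms(1)])
  also have "\<dots> \<le> exp (T / 2)" using assms(2) by simp
  finally show ?thesis
    unfolding norm_mult by (rule mult_left_mono) auto
qed

lemma H1_exp_has_sum:
  "((\<lambda>\<rho>. zero_weight \<rho> * exp ((\<rho> - 1 / 2) * of_real t)) has_sum H1 (exp t)) nontrivial_zeros"
  unfolding H1_exp
proof (rule has_sum_infsum, rule abs_summable_summable, rule Infinite_Sum.abs_summable_on_comparison_test')
  show "(\<lambda>\<rho>. norm (zero_weight \<rho>) * exp (\<bar>t\<bar> / 2)) summable_on nontrivial_zeros"
    by (rule summable_on_cmult_left[OF zero_weight_summable])
qed (rule zero_weight_exp_bound, auto)

lemma g_H1_has_sum:
  "((\<lambda>\<rho>. zero_weight \<rho> * (exp ((\<rho> - 1 / 2) * of_real t) - 1)) has_sum g_H1 t) nontrivial_zeros"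
proof -
  have "((\<lambda>\<rho>. zero_weight \<rho> * exp ((\<rho> - 1 / 2) * of_real t) + - (zero_weight \<rho> * exp ((\<rho> - 1 / 2) * of_real 0)))
      has_sum (H1 (exp t) + - H1 (exp 0))) nontrivial_zeros"
    by (intro has_sum_add has_sum_uminusI H1_exp_has_sum)
  then show ?thesis
    by (simp add: g_H1_def algebra_simps)
qed

lemma g_H1_0 [simp]: "g_H1 0 = 0"
  by (simp add: g_H1_def)

text \<open>The dominating bound grows with |t|, so the M-test gives uniform convergence on bounded
  intervals; continuity is local, so that suffices.\<close>

lemma g_H1_continuous: "continuous_on UNIV g_H1"
proof -
  have "continuous_on {-T<..<T} (\<lambda>t. H1 (exp t))" for T
    unfolding H1_exp
  proof (rule uniform_limit_theorem)
    show "uniform_limit {-T<..<T}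
       (\<lambda>X t. \<Sum>\<rho>\<in>X. zero_weight \<rho> * exp ((\<rho> - 1 / 2) * of_real t))
       (\<lambda>t. \<Sum>\<^sub>\<infinity>\<rho>\<in>nontrivial_zeros. zero_weight \<rho> * exp ((\<rho> - 1 / 2) * of_real t))
       (finite_subsets_at_top nontrivial_zeros)"
      by (rule Weierstrass_m_test_general[OF _ summable_on_cmult_left[OF zero_weight_summable]])
         (rule zero_weight_exp_bound[where T = T], auto)
  qed (auto intro!: always_eventually continuous_intros)
  then have "isCont (\<lambda>t. H1 (exp t)) t" for t
    by (rule continuous_on_interior[of "{- (\<bar>t\<bar> + 1)<..<\<bar>t\<bar> + 1}"]) auto
  then show ?thesis
    unfolding g_H1_def by (intro continuous_intros continuous_at_imp_continuous_on) auto
qed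

lemma has_sum_sum:
  fixes f :: "'i \<Rightarrow> 'a \<Rightarrow> 'b :: topological_comm_monoid_add"
  assumes "finite I" "\<And>i. i \<in> I \<Longrightarrow> (f i has_sum s i) A"
  shows "((\<lambda>x. \<Sum>i\<in>I. f i x) has_sum (\<Sum>i\<in>I. s i)) A"
  using assms by (induction I rule: finite_induct) (auto intro: has_sum_add)

text \<open>With x = exp (a t) and y = exp (-a u) the four terms of the kernel combine as xy - x - y
  + 1 = (x - 1)(y - 1). Each zero thus contributes a function of \<open>t\<close> times a function
  of \<open>u\<close>, wherever it lies in the strip.\<close>

lemma screw_kernel_g_H1_has_sum:
  "((\<lambda>\<rho>. zero_weight \<rho> * (exp ((\<rho> - 1 / 2) * of_real t) - 1) * (exp (- ((\<rho> - 1 / 2) * of_real u)) - 1))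
     has_sum screw_kernel g_H1 t u) nontrivial_zeros"
proof -
  let ?f = "\<lambda>t \<rho>. zero_weight \<rho> * (exp ((\<rho> - 1 / 2) * of_real t) - 1)"
  have "((\<lambda>\<rho>. ?f (t - u) \<rho> + - ?f t \<rho> + - ?f (- u) \<rho> + ?f 0 \<rho>) has_sum
      (g_H1 (t - u) + - g_H1 t + - g_H1 (- u) + g_H1 0)) nontrivial_zeros"
    by (intro has_sum_add has_sum_uminusI g_H1_has_sum)
  moreover have "?f (t - u) \<rho> + - ?f t \<rho> + - ?f (- u) \<rho> + ?f 0 \<rho> =
      zero_weight \<rho> * (exp ((\<rho> - 1 / 2) * of_real t) - 1) * (exp (- ((\<rho> - 1 / 2) * of_real u)) - 1)" for \<rho>
  proof -
    have e: "exp (a * of_real (t - u)) = exp (a * of_real t) * exp (- (a * of_real u))" for a :: complex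
      by (simp add: right_diff_distrib flip: exp_add)
    have alg: "w * (x * y - 1) + - (w * (x - 1)) + - (w * (y - 1)) + w * (1 - 1) = w * (x - 1) * (y - 1)"
      for w x y :: complex
      by (simp add: algebra_simps)
    show ?thesis
      by (simp only: e of_real_minus mult_minus_right of_real_0 mult_zero_right exp_zero alg)
  qed
  ultimately show ?thesis
    by (simp add: screw_kernel_def)
qed

text \<open>The denominator depends only on the square of \<open>\<rho> - 1 / 2\<close>, which on
  the critical line is \<open>- (Im \<rho>)^2\<close>; hence the positive weights there.\<close>

lemma zero_weight_eq:
  "zero_weight \<rho> = of_int (zorder riemann_zeta \<rho>) / (1 / 4 - (\<rho> - 1 / 2)\<^sup>2)"
  by (simp add: zero_weight_def power2_eq_square algebra_simps)

lemma RH_imp_screw_function: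
  assumes RH: "Riemann_Hypothesis"
  shows "screw_function g_H1"
proof -
  have re: "Re \<rho> = 1 / 2" if "\<rho> \<in> nontrivial_zeros" for \<rho>
    using RH that by (simp add: Riemann_Hypothesis_def)
  define w where "w = (\<lambda>\<rho>. real_of_int (zorder riemann_zeta \<rho>) / (1 / 4 + (Im \<rho>)\<^sup>2))"
  have w: "zero_weight \<rho> = of_real (w \<rho>)" "w \<rho> \<ge> 0" if "\<rho> \<in> nontrivial_zeros" for \<rho>
  proof -
    have "\<rho> - 1 / 2 = \<i> * of_real (Im \<rho>)"
      using re[OF that] by (simp add: complex_eq_iff)
    then show "zero_weight \<rho> = of_real (w \<rho>)"
      by (simp add: zero_weight_eq w_def power_mult_distrib)
    show "w \<rho> \<ge> 0"
      using zorder_zeta_pos[OF that] by (simp add: w_def)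
  qed
  \<comment> \<open>On the critical line \<open>\<rho> - 1 / 2\<close> is purely imaginary.
    Conjugation changes its sign, which makes the second kernel factor the conjugate of the first
    one at \<open>u\<close>.\<close>
  have cnj_exp: "cnj (exp ((\<rho> - 1 / 2) * of_real t)) = exp (- ((\<rho> - 1 / 2) * of_real t))"
    if "\<rho> \<in> nontrivial_zeros" for \<rho> t
  proof -
    have "cnj (\<rho> - 1 / 2) = - (\<rho> - 1 / 2)"
      using re[OF that] by (simp add: complex_eq_iff)
    then show ?thesis
      by (simp only: exp_cnj complex_cnj_mult complex_cnj_complex_of_real mult_minus_left)
  qed
  have sym: "g_H1 (- t) = cnj (g_H1 t)" for t
  proof (rule has_sum_unique[OF g_H1_has_sum])
    have "((\<lambda>\<rho>. cnj (zero_weight \<rho> * (exp ((\<rho> - 1 / 2) * of_real t) - 1))) has_sum cnj (g_H1 t)) nontrivial_zeros"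
      unfolding has_sum_cnj_iff by (rule g_H1_has_sum)
    also have "?this \<longleftrightarrow> ((\<lambda>\<rho>. zero_weight \<rho> * (exp ((\<rho> - 1 / 2) * of_real (- t)) - 1)) has_sum cnj (g_H1 t)) nontrivial_zeros"
    proof (rule has_sum_cong)
      fix \<rho> assume \<rho>: "\<rho> \<in> nontrivial_zeros"
      show "cnj (zero_weight \<rho> * (exp ((\<rho> - 1 / 2) * of_real t) - 1)) =
          zero_weight \<rho> * (exp ((\<rho> - 1 / 2) * of_real (- t)) - 1)"
        by (simp only: complex_cnj_mult complex_cnj_diff complex_cnj_one cnj_exp[OF \<rho>] w(1)[OF \<rho>]
            complex_cnj_complex_of_real of_real_minus mult_minus_right)
    qed
    finally show "((\<lambda>\<rho>. zero_weight \<rho> * (exp ((\<rho> - 1 / 2) * of_real (- t)) - 1)) has_sum cnj (g_H1 t)) nontrivial_zeros" .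
  qed
  have "nonneg_definite_kernel (screw_kernel g_H1)"
    unfolding nonneg_definite_kernel_def
  proof (intro allI impI)
    fix n :: nat and t :: "nat \<Rightarrow> real" and \<xi> :: "nat \<Rightarrow> complex"
    let ?S = "\<Sum>i=1..n. \<Sum>j=1..n. screw_kernel g_H1 (t i) (t j) * \<xi> i * cnj (\<xi> j)"
    \<comment> \<open>The double sum attached to one zero becomes \<open>w \<rho>\<close> times the
      squared modulus of \<open>v \<rho>\<close>.\<close>
    define v where "v = (\<lambda>\<rho>. \<Sum>i=1..n. (exp ((\<rho> - 1 / 2) * of_real (t i)) - 1) * \<xi> i)"
    have "((\<lambda>\<rho>. \<Sum>i=1..n. \<Sum>j=1..n. zero_weight \<rho> * (exp ((\<rho> - 1 / 2) * of_real (t i)) - 1) *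
        (exp (- ((\<rho> - 1 / 2) * of_real (t j))) - 1) * \<xi> i * cnj (\<xi> j)) has_sum ?S) nontrivial_zeros"
      by (intro has_sum_sum has_sum_cmult_left screw_kernel_g_H1_has_sum) auto
    also have "?this \<longleftrightarrow> ((\<lambda>\<rho>. of_real (w \<rho> * (norm (v \<rho>))\<^sup>2)) has_sum ?S) nontrivial_zeros"
    proof (rule has_sum_cong)
      fix \<rho> assume \<rho>: "\<rho> \<in> nontrivial_zeros"
      have "complex_of_real (w \<rho> * (norm (v \<rho>))\<^sup>2) = of_real (w \<rho>) * (v \<rho> * cnj (v \<rho>))"
        by (simp only: of_real_mult complex_norm_square)
      also have "cnj (v \<rho>) = (\<Sum>j=1..n. (exp (- ((\<rho> - 1 / 2) * of_real (t j))) - 1) * cnj (\<xi> j))"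
        unfolding v_def by (simp only: cnj_sum complex_cnj_mult complex_cnj_diff complex_cnj_one cnj_exp[OF \<rho>])
      also have "of_real (w \<rho>) * (v \<rho> * \<dots>) = (\<Sum>i=1..n. \<Sum>j=1..n. zero_weight \<rho> * (exp ((\<rho> - 1 / 2) * of_real (t i)) - 1) *
        (exp (- ((\<rho> - 1 / 2) * of_real (t j))) - 1) * \<xi> i * cnj (\<xi> j))"
        unfolding v_def unfolding sum_product unfolding sum_distrib_left w(1)[OF \<rho>] by (intro sum.cong refl) (simp only: mult_ac)
      finally show "(\<Sum>i=1..n. \<Sum>j=1..n. zero_weight \<rho> * (exp ((\<rho> - 1 / 2) * of_real (t i)) - 1) *
        (exp (- ((\<rho> - 1 / 2) * of_real (t j))) - 1) * \<xi> i * cnj (\<xi> j)) = of_real (w \<rho> * (norm (v \<rho>))\<^sup>2)" ..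
    qed
    finally have S: "((\<lambda>\<rho>. complex_of_real (w \<rho> * (norm (v \<rho>))\<^sup>2)) has_sum ?S) nontrivial_zeros" .
    have "Re ?S \<ge> 0"
      by (rule has_sum_nonneg[OF has_sum_Re[OF S]]) (simp add: w)
    moreover have "Im ?S = 0"
      using has_sum_unique[OF has_sum_Im[OF S], of 0] by simp
    ultimately show "?S \<in> \<real>\<^sub>\<ge>\<^sub>0"
      by (simp add: complex_nonneg_Reals_iff)
  qed
  then show ?thesis
    using sym g_H1_continuous by (simp add: screw_function_def)
qed

section \<open>Laplace transforms of functions of quadratic growth\<close>

text \<open>The improper integral over t \<ge> 0, cut at the integers: for continuous
  \<open>\<phi>\<close> every piece is entire in \<open>z\<close>, and holomorphy becomes a matter
  of dominating a sum.\<close>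

definition laplace :: "(real \<Rightarrow> complex) \<Rightarrow> complex \<Rightarrow> complex" where
  "laplace \<phi> z = (\<Sum>\<^sub>\<infinity>n. integral {real n..real n + 1} (\<lambda>t. \<phi> t * exp (- z * of_real t)))"

lemma laplace_piece_holomorphic:
  assumes \<phi>: "continuous_on UNIV \<phi>"
  shows "(\<lambda>z. integral {a..b} (\<lambda>t. \<phi> t * exp (- z * of_real t))) holomorphic_on UNIV"
proof -
  have "(\<lambda>z. integral (cbox a b) (\<lambda>t. \<phi> t * exp (- z * of_real t))) holomorphic_on UNIV"
  proof (rule leibniz_rule_holomorphic)
    fix z :: complex and t :: real
    show "((\<lambda>z. \<phi> t * exp (- z * of_real t)) has_field_derivative
        \<phi> t * (- of_real t) * exp (- z * of_real t)) (at z within UNIV)"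
      by (auto intro!: derivative_eq_intros)
    show "(\<lambda>t. \<phi> t * exp (- z * of_real t)) integrable_on cbox a b"
      by (intro integrable_continuous continuous_intros continuous_on_subset[OF \<phi>]) auto
  next
    have "continuous_on (UNIV \<times> cbox a b) (\<lambda>p. \<phi> (snd p :: real))"
      by (rule continuous_on_compose2[OF \<phi>]) (auto intro!: continuous_intros)
    then show "continuous_on (UNIV \<times> cbox a b) (\<lambda>(z, t). \<phi> t * (- of_real t) * exp (- z * of_real t))"
      unfolding case_prod_unfold by (intro continuous_intros) auto
  qed auto
  then show ?thesis by simp
qed

lemma laplace_piece_bound:
  assumes \<phi>: "continuous_on UNIV \<phi>" and C: "\<And>t. t \<ge> 0 \<Longrightarrow> norm (\<phi> t) \<le> C * (1 + t)\<^sup>2"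
    and c: "c \<ge> 0" "Re z \<ge> c"
  shows "norm (integral {real n..real n + 1} (\<lambda>t. \<phi> t * exp (- z * of_real t)))
           \<le> C * ((2 + real n)\<^sup>2 * exp (- c * real n))"
proof -
  have C0: "C \<ge> 0" using order.trans[OF norm_ge_zero C[of 0]] by simp
  have "norm (integral {real n..real n + 1} (\<lambda>t. \<phi> t * exp (- z * of_real t)))
      \<le> C * ((2 + real n)\<^sup>2 * exp (- c * real n)) * (real n + 1 - real n)"
  proof (rule integral_bound)
    show "continuous_on {real n..real n + 1} (\<lambda>t. \<phi> t * exp (- z * of_real t))"
      by (intro continuous_intros continuous_on_subset[OF \<phi>]) auto
    fix t assume t: "t \<in> {real n..real n + 1}"
    have "norm (\<phi> t) \<le> C * (1 + t)\<^sup>2" using t by (intro C) auto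
    also have "\<dots> \<le> C * (2 + real n)\<^sup>2"
      using t by (intro mult_left_mono power_mono C0) auto
    finally have 1: "norm (\<phi> t) \<le> C * (2 + real n)\<^sup>2" .
    have "c * real n \<le> Re z * t"
      by (rule mult_mono) (use c t in auto)
    then have "norm (exp (- z * of_real t)) \<le> exp (- c * real n)" by simp
    with 1 have "norm (\<phi> t) * norm (exp (- z * of_real t)) \<le> C * (2 + real n)\<^sup>2 * exp (- c * real n)"
      by (intro mult_mono) (use C0 in auto)
    then show "norm (\<phi> t * exp (- z * of_real t)) \<le> C * ((2 + real n)\<^sup>2 * exp (- c * real n))"
      by (simp only: norm_mult mult.assoc)
  qed auto
  then show ?thesis by simp
qed

lemma summable_on_quadratic_exp:
  assumes "c > 0"
  shows "(\<lambda>n. (2 + real n)\<^sup>2 * exp (- c * real n)) summable_on UNIV"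
proof (rule norm_summable_imp_summable_on)
  have "(\<lambda>n. (2 + real n)\<^sup>2 * exp (- c * real n)) \<in> O(\<lambda>n. real n powr (-2))"
    using assms by real_asymp
  then have "summable (\<lambda>n. (2 + real n)\<^sup>2 * exp (- c * real n))"
    by (rule summable_comparison_test_bigo[rotated]) (simp add: summable_real_powr_iff)
  then show "summable (\<lambda>n. norm ((2 + real n)\<^sup>2 * exp (- c * real n)))"
    by simp
qed

lemma laplace_holomorphic:
  assumes \<phi>: "continuous_on UNIV \<phi>" and C: "\<And>t. t \<ge> 0 \<Longrightarrow> norm (\<phi> t) \<le> C * (1 + t)\<^sup>2"
  shows "laplace \<phi> holomorphic_on {z. Re z > 0}"
proof -
  have "(\<lambda>z. \<Sum>\<^sub>\<infinity>n. integral {real n..real n + 1} (\<lambda>t. \<phi> t * exp (- z * of_real t)))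
      holomorphic_on {z. Re z > 0}"
  proof (rule holomorphic_on_infsum)
    show "open {z. Re z > 0}" by (rule open_halfspace_Re_gt)
    fix z assume z: "z \<in> {z. Re z > 0}"
    define d where "d = Re z / 2"
    have d: "d > 0" using z by (simp add: d_def)
    have re: "Re w \<ge> d" if "w \<in> cball z d" for w
    proof -
      have "Re z - Re w \<le> d"
        using that complex_Re_le_cmod[of "z - w"] by (auto simp: dist_norm)
      then show ?thesis unfolding d_def by (simp add: field_simps)
    qed
    show "\<exists>d>0. \<exists>M. cball z d \<subseteq> {z. Re z > 0} \<and> M summable_on UNIV \<and>
        (\<forall>n\<in>UNIV. \<forall>w\<in>cball z d. norm (integral {real n..real n + 1} (\<lambda>t. \<phi> t * exp (- w * of_real t))) \<le> M n)"
    proof (intro exI[of _ d] conjI exI[of _ "\<lambda>n. C * ((2 + real n)\<^sup>2 * exp (- d * real n))"] ballI)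
      show "(\<lambda>n. C * ((2 + real n)\<^sup>2 * exp (- d * real n))) summable_on UNIV"
        by (intro summable_on_cmult_right summable_on_quadratic_exp d)
      show "cball z d \<subseteq> {z. Re z > 0}" using re d by force
      fix n w assume "w \<in> cball z d"
      then show "norm (integral {real n..real n + 1} (\<lambda>t. \<phi> t * exp (- w * of_real t)))
          \<le> C * ((2 + real n)\<^sup>2 * exp (- d * real n))"
        using d re by (intro laplace_piece_bound \<phi> C) auto
    qed (rule d)
  qed (use laplace_piece_holomorphic[OF \<phi>] holomorphic_on_subset in blast)
  then show ?thesis by (simp add: laplace_def[abs_def])
qed

text \<open>This returns from the sum of pieces to integrals over \<open>{0..N}\<close>, the form in
  which the transform of a sum of exponentials is computed.\<close>

lemma laplace_tendsto:
  assumes \<phi>: "continuous_on UNIV \<phi>" and C: "\<And>t. t \<ge> 0 \<Longrightarrow> norm (\<phi> t) \<le> C * (1 + t)\<^sup>2" and z: "Re z > 0"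
  shows "(\<lambda>N. integral {0..real N} (\<lambda>t. \<phi> t * exp (- z * of_real t))) \<longlonglongrightarrow> laplace \<phi> z"
proof -
  let ?f = "\<lambda>t. \<phi> t * exp (- z * of_real t)"
  have int: "?f integrable_on {a..b}" for a b
    by (intro integrable_continuous_real continuous_intros continuous_on_subset[OF \<phi>]) auto
  have "(\<lambda>n. norm (integral {real n..real n + 1} ?f)) summable_on UNIV"
  proof (rule Infinite_Sum.abs_summable_on_comparison_test')
    show "(\<lambda>n. C * ((2 + real n)\<^sup>2 * exp (- Re z * real n))) summable_on UNIV"
      by (intro summable_on_cmult_right summable_on_quadratic_exp z)
    show "norm (integral {real n..real n + 1} ?f) \<le> C * ((2 + real n)\<^sup>2 * exp (- Re z * real n))" for n
      using z by (intro laplace_piece_bound \<phi> C) auto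
  qed
  from has_sum_imp_sums[OF has_sum_infsum[OF abs_summable_summable[OF this]]]
  have "(\<lambda>n. integral {real n..real n + 1} ?f) sums laplace \<phi> z"
    by (simp add: laplace_def)
  moreover have "(\<Sum>n<N. integral {real n..real n + 1} ?f) = integral {0..real N} ?f" for N
  proof (induction N)
    case (Suc N)
    have "integral {0..real N} ?f + integral {real N..real N + 1} ?f = integral {0..real N + 1} ?f"
      by (rule Henstock_Kurzweil_Integration.integral_combine[OF _ _ int]) auto
    with Suc show ?case by (simp add: add.commute)
  qed simp
  ultimately show ?thesis by (simp add: sums_def)
qed

section \<open>Screw functions grow at most quadratically\<close>

text \<open>In terms of Hilbert space vectors x_t with Gram kernel G, \<phi>(t) is |x_t|^2 and |x_t
  - x_u|^2 = \<phi>(t - u). So x_(2t) is reached by two steps of length |x_t|, and the triangle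
  inequality bounds |x_(2t)| by 2 |x_t|.\<close>

lemma screw_function_growth:
  assumes g: "screw_function g" and g0: "g 0 = 0"
  obtains C where "\<And>t. t \<ge> 0 \<Longrightarrow> norm (- (g t + g (- t))) \<le> C * (1 + t)\<^sup>2"
proof -
  define \<phi> where "\<phi> = (\<lambda>t. - (g t + g (- t)))"
  have psd: "(\<Sum>i=1..n. \<Sum>j=1..n. screw_kernel g (t i) (t j) * \<xi> i * cnj (\<xi> j)) \<in> \<real>\<^sub>\<ge>\<^sub>0"
    if "n > 0" for n and t :: "nat \<Rightarrow> real" and \<xi> :: "nat \<Rightarrow> complex"
  proof -
    have "nonneg_definite_kernel (screw_kernel g)"
      using g by (simp add: screw_function_def)
    then show ?thesis
      using that unfolding nonneg_definite_kernel_def by blast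
  qed
  have norm_\<phi>: "norm (\<phi> t) = Re (\<phi> t)" for t
  proof -
    have "\<phi> t \<in> \<real>\<^sub>\<ge>\<^sub>0"
      using psd[of 1 "\<lambda>_. t" "\<lambda>_. 1"] by (simp add: screw_kernel_def g0 \<phi>_def algebra_simps)
    then show ?thesis
      by (simp add: complex_nonneg_Reals_iff cmod_eq_Re)
  qed
  have double: "norm (\<phi> (2 * t)) \<le> 4 * norm (\<phi> t)" for t
  proof -
    define T where "T = (\<lambda>i :: nat. if i = 1 then t else 2 * t)"
    \<comment> \<open>These coefficients form 2 x_t - x_(2t), whose squared length is 4 \<phi>(t) -
      \<phi>(2t).\<close>
    define X where "X = (\<lambda>i :: nat. if i = 1 then 2 else -1 :: complex)"
    have "(\<Sum>i=1..2. \<Sum>j=1..2. screw_kernel g (T i) (T j) * X i * cnj (X j)) = 4 * \<phi> t - \<phi> (2 * t)"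
      by (simp add: numeral_2_eq_2 T_def X_def screw_kernel_def g0 \<phi>_def algebra_simps)
    then have "4 * \<phi> t - \<phi> (2 * t) \<in> \<real>\<^sub>\<ge>\<^sub>0"
      using psd[of 2 T X] by simp
    then show ?thesis
      by (simp add: complex_nonneg_Reals_iff norm_\<phi>)
  qed
  have "continuous_on {0..1} \<phi>"
  proof -
    have "continuous_on UNIV g" using g by (simp add: screw_function_def)
    then have "continuous_on {0..1} (\<lambda>t. g t)" "continuous_on {0..1} (\<lambda>t. g (- t))"
      by (rule continuous_on_compose2; simp add: continuous_on_minus continuous_on_id)+
    then show ?thesis
      unfolding \<phi>_def by (intro continuous_on_minus continuous_on_add)
  qed
  then obtain B where B: "B \<ge> 0" "\<And>t. t \<in> {0..1} \<Longrightarrow> norm (\<phi> t) \<le> B"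
    using continuous_on_unit_bound by blast
  \<comment> \<open>Doubling preserves a bound of the form c t^2. The range starts at 1/2 so that
    halving a t \<ge> 1 stays inside it, and on [1/2, 1] the factor 4 makes up for t^2 \<ge>
    1/4.\<close>
  have dyadic: "norm (\<phi> t) \<le> 4 * B * t\<^sup>2" if "1 / 2 \<le> t" "t \<le> 2 ^ k" for k t
    using that
  proof (induction k arbitrary: t)
    case 0
    have "(1 / 2)\<^sup>2 \<le> t\<^sup>2" using 0 by (intro power_mono) auto
    then have "B * 1 \<le> B * (4 * t\<^sup>2)"
      by (intro mult_left_mono B) (simp add: power2_eq_square)
    moreover have "norm (\<phi> t) \<le> B" using 0 by (intro B) auto
    ultimately show ?case by simp
  next
    case (Suc k)
    show ?case
    proof (cases "t \<le> 2 ^ k")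
      case True
      then show ?thesis using Suc by blast
    next
      case False
      have "(1 :: real) \<le> 2 ^ k" by simp
      with False have "t \<ge> 1" by linarith
      then have "norm (\<phi> (t / 2)) \<le> 4 * B * (t / 2)\<^sup>2"
        using Suc.prems by (intro Suc.IH) auto
      then show ?thesis
        using double[of "t / 2"] by (simp add: power_divide)
    qed
  qed
  have "norm (\<phi> t) \<le> 4 * B * (1 + t)\<^sup>2" if t: "t \<ge> 0" for t
  proof (cases "t \<le> 1 / 2")
    case True
    have "1 \<le> (1 + t)\<^sup>2" using t by simp
    then have "B * 1 \<le> B * (4 * (1 + t)\<^sup>2)"
      by (intro mult_left_mono B) simp
    moreover have "norm (\<phi> t) \<le> B" using t True by (intro B) auto
    ultimately show ?thesis by simp
  next
    case False
    obtain k where "t < 2 ^ k"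
      using real_arch_pow[of 2 t] by auto
    with False have "norm (\<phi> t) \<le> 4 * B * t\<^sup>2" by (intro dyadic[where k = k]) auto
    also have "\<dots> \<le> 4 * B * (1 + t)\<^sup>2"
      using t B by (intro mult_left_mono power_mono) auto
    finally show ?thesis .
  qed
  then show ?thesis using that unfolding \<phi>_def by blast
qed

section \<open>Poles of the Laplace transform\<close>

definition sym_g :: "real \<Rightarrow> complex" where
  "sym_g t = - (g_H1 t + g_H1 (- t))"

definition zero_term :: "complex \<Rightarrow> real \<Rightarrow> complex" where
  "zero_term \<rho> t = zero_weight \<rho> * (2 - exp ((\<rho> - 1 / 2) * of_real t) - exp (- (\<rho> - 1 / 2) * of_real t))"

lemma sym_g_continuous: "continuous_on UNIV sym_g"
  unfolding sym_g_def
  by (intro continuous_on_minus continuous_on_add continuous_on_compose2[OF g_H1_continuous])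
     (auto intro: continuous_intros)

lemma sym_g_has_sum: "((\<lambda>\<rho>. zero_term \<rho> t) has_sum sym_g t) nontrivial_zeros"
proof -
  have "((\<lambda>\<rho>. - (zero_weight \<rho> * (exp ((\<rho> - 1 / 2) * of_real t) - 1)
      + zero_weight \<rho> * (exp ((\<rho> - 1 / 2) * of_real (- t)) - 1))) has_sum sym_g t) nontrivial_zeros"
    unfolding sym_g_def by (intro has_sum_uminusI has_sum_add g_H1_has_sum)
  moreover have "- (w * (x - 1) + w * (y - 1)) = w * (2 - x - y)" for w x y :: complex
    by (simp add: algebra_simps)
  ultimately show ?thesis
    by (simp only: zero_term_def of_real_minus mult_minus_right mult_minus_left)
qed

lemma zero_term_bound:
  assumes "\<rho> \<in> nontrivial_zeros" "\<bar>t\<bar> \<le> T"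
  shows "norm (zero_term \<rho> t) \<le> norm (zero_weight \<rho>) * (2 + 2 * exp (T / 2))"
proof -
  have e: "norm (exp ((\<rho> - 1 / 2) * of_real s)) \<le> exp (T / 2)" if "\<bar>s\<bar> = \<bar>t\<bar>" for s
    using norm_exp_zero_le[OF assms(1), of s] that assms(2)
    by (elim order.trans) simp
  have "norm (2 - exp ((\<rho> - 1 / 2) * of_real t) - exp ((\<rho> - 1 / 2) * of_real (- t)))
      \<le> norm (2 :: complex) + norm (exp ((\<rho> - 1 / 2) * of_real t)) + norm (exp ((\<rho> - 1 / 2) * of_real (- t)))"
    by (intro order.trans[OF norm_triangle_ineq4] add_right_mono norm_triangle_ineq4)
  also have "\<dots> \<le> 2 + exp (T / 2) + exp (T / 2)"
    by (intro add_mono e) auto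
  also have "\<dots> = 2 + 2 * exp (T / 2)" by simp
  finally have bound: "norm (2 - exp ((\<rho> - 1 / 2) * of_real t) - exp ((\<rho> - 1 / 2) * of_real (- t)))
      \<le> 2 + 2 * exp (T / 2)" .
  have "- (\<rho> - 1 / 2) * of_real t = (\<rho> - 1 / 2) * of_real (- t)"
    by (simp only: of_real_minus mult_minus_right mult_minus_left)
  with bound show ?thesis
    unfolding zero_term_def norm_mult by (intro mult_left_mono) (simp_all only: norm_ge_zero)
qed

text \<open>The transform of exp (b t) cut off at \<open>N\<close>. The range is kept finite because
  the sum over zeros converges uniformly only on bounded intervals and is to be integrated term by
  term.\<close>

definition exp_integral :: "complex \<Rightarrow> complex \<Rightarrow> nat \<Rightarrow> complex" where
  "exp_integral b z N = (1 - exp ((b - z) * of_nat N)) / (z - b)"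

lemma exp_integral_has_integral:
  assumes "z \<noteq> b"
  shows "((\<lambda>t. exp (b * of_real t) * exp (- z * of_real t)) has_integral exp_integral b z N) {0..real N}"
proof -
  have "((\<lambda>t. exp (b * of_real t) * exp (- z * of_real t)) has_integral
      (exp ((b - z) * of_real (real N)) / (b - z) - exp ((b - z) * of_real 0) / (b - z))) {0..real N}"
  proof (rule fundamental_theorem_of_calculus)
    fix t
    have "((\<lambda>y. exp ((b - z) * y) / (b - z)) has_field_derivative exp ((b - z) * of_real t)) (at (complex_of_real t))"
      using assms by (auto intro!: derivative_eq_intros)
    then have "((\<lambda>t. exp ((b - z) * of_real t) / (b - z)) has_vector_derivative exp ((b - z) * of_real t))
        (at t within {0..real N})"
      by (rule has_vector_derivative_real_field)
    then show "((\<lambda>t. exp ((b - z) * of_real t) / (b - z)) has_vector_derivative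
        exp (b * of_real t) * exp (- z * of_real t)) (at t within {0..real N})"
      by (simp add: algebra_simps flip: exp_add)
  qed simp
  moreover have "x / (b - z) - y / (b - z) = (y - x) / (z - b)" for x y
  proof -
    have "b - z = - (z - b)" by simp
    then show ?thesis by (simp only: diff_divide_distrib divide_minus_right) simp
  qed
  then have "exp ((b - z) * of_real (real N)) / (b - z) - exp ((b - z) * of_real 0) / (b - z) = exp_integral b z N"
    by (simp add: exp_integral_def)
  ultimately show ?thesis by simp
qed

text \<open>The error is uniform over all exponents in question, so the limit in \<open>N\<close>
  can be taken inside the sum over zeros. The gap 1/2 between \<open>Re b\<close> and
  \<open>Re z\<close> supplies both the distance from the pole and the decay rate.\<close>

lemma exp_integral_bound:
  assumes "Re b \<le> 1 / 2" "Re z \<ge> 1"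
  shows "norm (exp_integral b z N - 1 / (z - b)) \<le> 2 * exp (- (real N / 2))"
proof -
  have "1 / 2 \<le> Re (z - b)" using assms by simp
  also have "\<dots> \<le> norm (z - b)" by (rule complex_Re_le_cmod)
  finally have 1: "1 / 2 \<le> norm (z - b)" .
  then have nz: "z - b \<noteq> 0" by auto
  have "Re (b - z) * real N \<le> - (1 / 2) * real N"
    using assms by (intro mult_right_mono) auto
  then have 2: "norm (exp ((b - z) * of_nat N)) \<le> exp (- (real N / 2))" by simp
  have "exp_integral b z N - 1 / (z - b) = - exp ((b - z) * of_nat N) / (z - b)"
    by (simp add: exp_integral_def flip: diff_divide_distrib)
  then have "norm (exp_integral b z N - 1 / (z - b)) = norm (exp ((b - z) * of_nat N)) / norm (z - b)"
    by (simp only: norm_divide norm_minus_cancel)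
  also have "\<dots> \<le> exp (- (real N / 2)) / (1 / 2)"
    by (rule frac_le) (use 1 2 in auto)
  finally show ?thesis by simp
qed

text \<open>The Laplace transform of exp (a t) + exp (-a t) for a = \<rho> - 1/2, continued beyond
  its half-plane of convergence.\<close>

definition pole_term :: "complex \<Rightarrow> complex \<Rightarrow> complex" where
  "pole_term z \<rho> = 1 / (z - (\<rho> - 1 / 2)) + 1 / (z + (\<rho> - 1 / 2))"

lemma nontrivial_zeros_Re: "\<rho> \<in> nontrivial_zeros \<Longrightarrow> \<bar>Re (\<rho> - 1 / 2)\<bar> \<le> 1 / 2"
  unfolding abs_le_iff by (auto simp: nontrivial_zeros_def)

lemma zero_weight_abs_summable: "zero_weight summable_on nontrivial_zeros"
  by (rule abs_summable_summable[OF zero_weight_summable])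

text \<open>The series is integrated term by term over \<open>{0..N}\<close>; then \<open>N\<close>
  grows, with an error O(exp (-N/2)) times the sum of the norms of the weights. The growth
  hypothesis identifies the limit of the cut-off integrals with
  \<open>laplace sym_g z\<close>.\<close>

lemma laplace_sym_g:
  assumes growth: "\<And>t. t \<ge> 0 \<Longrightarrow> norm (sym_g t) \<le> C * (1 + t)\<^sup>2" and z: "Re z \<ge> 1"
  shows "((\<lambda>\<rho>. zero_weight \<rho> * (2 / z - pole_term z \<rho>)) has_sum laplace sym_g z) nontrivial_zeros"
proof -
  define I where "I = (\<lambda>N \<rho>. zero_weight \<rho> * (2 * exp_integral 0 z N
      - exp_integral (\<rho> - 1 / 2) z N - exp_integral (- (\<rho> - 1 / 2)) z N))"
  define L where "L = (\<lambda>\<rho>. zero_weight \<rho> * (2 / z - pole_term z \<rho>))"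
  have ne: "z \<noteq> \<rho> - 1 / 2" "z \<noteq> - (\<rho> - 1 / 2)" if "\<rho> \<in> nontrivial_zeros" for \<rho>
    using nontrivial_zeros_Re[OF that] z by (auto simp: abs_le_iff)
  have z0: "z \<noteq> 0" using z by auto
  have term_integral: "((\<lambda>t. zero_term \<rho> t * exp (- z * of_real t)) has_integral I N \<rho>) {0..real N}"
    if \<rho>: "\<rho> \<in> nontrivial_zeros" for \<rho> N
  proof -
    have "((\<lambda>t. zero_weight \<rho> * (2 * (exp (0 * of_real t) * exp (- z * of_real t))
        - exp ((\<rho> - 1 / 2) * of_real t) * exp (- z * of_real t)
        - exp (- (\<rho> - 1 / 2) * of_real t) * exp (- z * of_real t))) has_integral I N \<rho>) {0..real N}"
      unfolding I_def by (intro has_integral_mult_right has_integral_diff exp_integral_has_integral ne \<rho> z0)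
    moreover have "w * (2 * (exp (0 * u) * e) - x * e - y * e) = w * (2 - x - y) * e" for w u e x y :: complex
      by (simp add: algebra_simps)
    ultimately show ?thesis by (simp only: zero_term_def)
  qed
  have I_sum: "(I N has_sum integral {0..real N} (\<lambda>t. sym_g t * exp (- z * of_real t))) nontrivial_zeros" for N
  proof -
    define B where "B = exp (\<bar>Re z\<bar> * real N)"
    have lim: "uniform_limit {0..real N} (\<lambda>X t. \<Sum>\<rho>\<in>X. zero_term \<rho> t * exp (- z * of_real t))
        (\<lambda>t. sym_g t * exp (- z * of_real t)) (finite_subsets_at_top nontrivial_zeros)"
    proof (rule Weierstrass_m_test_general')
      show "(\<lambda>\<rho>. norm (zero_weight \<rho>) * ((2 + 2 * exp (real N / 2)) * B)) summable_on nontrivial_zeros"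
        by (rule summable_on_cmult_left[OF zero_weight_summable])
      fix \<rho> t assume \<rho>: "\<rho> \<in> nontrivial_zeros" and t: "t \<in> {0..real N}"
      have "- Re z * t \<le> \<bar>Re z\<bar> * real N"
        using t by (intro mult_mono) auto
      then have "norm (exp (- z * of_real t)) \<le> B" by (simp add: B_def)
      moreover have "norm (zero_term \<rho> t) \<le> norm (zero_weight \<rho>) * (2 + 2 * exp (real N / 2))"
        using t by (intro zero_term_bound \<rho>) auto
      ultimately have "norm (zero_term \<rho> t) * norm (exp (- z * of_real t))
          \<le> norm (zero_weight \<rho>) * (2 + 2 * exp (real N / 2)) * B"
        by (intro mult_mono) auto
      then show "norm (zero_term \<rho> t * exp (- z * of_real t))
          \<le> norm (zero_weight \<rho>) * ((2 + 2 * exp (real N / 2)) * B)"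
        by (simp only: norm_mult mult.assoc)
    next
      fix t
      show "((\<lambda>\<rho>. zero_term \<rho> t * exp (- z * of_real t)) has_sum sym_g t * exp (- z * of_real t)) nontrivial_zeros"
        by (intro has_sum_cmult_left sym_g_has_sum)
    qed
    obtain J K where JK: "\<And>X. ((\<lambda>t. \<Sum>\<rho>\<in>X. zero_term \<rho> t * exp (- z * of_real t)) has_integral J X) {0..real N}"
      "((\<lambda>t. sym_g t * exp (- z * of_real t)) has_integral K) {0..real N}"
      "(J \<longlongrightarrow> K) (finite_subsets_at_top nontrivial_zeros)"
    proof (rule uniform_limit_integral[OF lim])
      show "continuous_on {0..real N} (\<lambda>t. \<Sum>\<rho>\<in>X. zero_term \<rho> t * exp (- z * of_real t))" for X
        unfolding zero_term_def by (intro continuous_intros)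
    qed auto
    have "\<forall>\<^sub>F X in finite_subsets_at_top nontrivial_zeros. J X = (\<Sum>\<rho>\<in>X. I N \<rho>)"
    proof (rule eventually_finite_subsets_at_top_weakI)
      fix X assume X: "finite X" "X \<subseteq> nontrivial_zeros"
      have "((\<lambda>t. \<Sum>\<rho>\<in>X. zero_term \<rho> t * exp (- z * of_real t)) has_integral (\<Sum>\<rho>\<in>X. I N \<rho>)) {0..real N}"
        by (intro has_integral_sum X term_integral) (use X in auto)
      then show "J X = (\<Sum>\<rho>\<in>X. I N \<rho>)"
        by (rule has_integral_unique[OF JK(1)])
    qed
    with JK(3) have "((\<lambda>X. \<Sum>\<rho>\<in>X. I N \<rho>) \<longlongrightarrow> K) (finite_subsets_at_top nontrivial_zeros)"
      by (rule Lim_transform_eventually)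
    then show ?thesis
      using integral_unique[OF JK(2)] by (simp add: has_sum_def)
  qed
  \<comment> \<open>Three cut-off errors with coefficients 2, 1 and 1, each at most
    \<open>2 * exp (- (N / 2))\<close>, make 8.\<close>
  have diff: "norm (I N \<rho> - L \<rho>) \<le> norm (zero_weight \<rho>) * (8 * exp (- (real N / 2)))"
    if \<rho>: "\<rho> \<in> nontrivial_zeros" for N \<rho>
  proof -
    define E where "E = (\<lambda>b. exp_integral b z N - 1 / (z - b))"
    have E: "norm (E b) \<le> 2 * exp (- (real N / 2))" if "Re b \<le> 1 / 2" for b
      unfolding E_def by (rule exp_integral_bound[OF that z])
    have re: "Re (\<rho> - 1 / 2) \<le> 1 / 2" "Re (- (\<rho> - 1 / 2)) \<le> 1 / 2"
      using nontrivial_zeros_Re[OF \<rho>] unfolding abs_le_iff by simp_all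
    have alg: "w * (2 * x0 - x1 - x2) - w * (2 * y0 - (y1 + y2)) = w * (2 * (x0 - y0) - (x1 - y1) - (x2 - y2))"
      for w x0 x1 x2 y0 y1 y2 :: complex
      by (simp add: algebra_simps)
    have L: "L \<rho> = zero_weight \<rho> * (2 * (1 / (z - 0)) - (1 / (z - (\<rho> - 1 / 2)) + 1 / (z - (- (\<rho> - 1 / 2)))))"
      by (simp add: L_def pole_term_def)
    have "I N \<rho> - L \<rho> = zero_weight \<rho> * (2 * E 0 - E (\<rho> - 1 / 2) - E (- (\<rho> - 1 / 2)))"
      unfolding L I_def E_def by (rule alg)
    moreover have "norm (2 * E 0 - E (\<rho> - 1 / 2) - E (- (\<rho> - 1 / 2)))
        \<le> norm (2 * E 0) + norm (E (\<rho> - 1 / 2)) + norm (E (- (\<rho> - 1 / 2)))"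
      by (intro order.trans[OF norm_triangle_ineq4] add_right_mono norm_triangle_ineq4)
    moreover have "\<dots> \<le> 8 * exp (- (real N / 2))"
    proof -
      have "norm (2 * E 0) = 2 * norm (E 0)" by (simp add: norm_mult)
      with E[of 0] E[OF re(1)] E[OF re(2)] show ?thesis by simp
    qed
    ultimately show ?thesis
      by (simp add: norm_mult mult_left_mono)
  qed
  define W where "W = (\<Sum>\<^sub>\<infinity>\<rho>\<in>nontrivial_zeros. norm (zero_weight \<rho>))"
  have L_summable: "L summable_on nontrivial_zeros"
  proof -
    \<comment> \<open>At \<open>N = 0\<close> the integrals vanish, so \<open>diff\<close> becomes a
      bound on \<open>L\<close> itself.\<close>
    have "(\<lambda>\<rho>. I 0 \<rho> - L \<rho>) summable_on nontrivial_zeros"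
    proof (rule abs_summable_summable, rule Infinite_Sum.abs_summable_on_comparison_test'[OF _ diff])
      show "(\<lambda>\<rho>. norm (zero_weight \<rho>) * (8 * exp (- (real 0 / 2)))) summable_on nontrivial_zeros"
        by (rule summable_on_cmult_left[OF zero_weight_summable])
    qed
    moreover have "I 0 = (\<lambda>_. 0)" by (simp add: I_def exp_integral_def fun_eq_iff)
    ultimately show ?thesis by (simp add: summable_on_uminus)
  qed
  have dist: "norm (integral {0..real N} (\<lambda>t. sym_g t * exp (- z * of_real t)) - infsum L nontrivial_zeros)
      \<le> W * (8 * exp (- (real N / 2)))" for N
  proof (rule norm_infsum_le)
    have "((\<lambda>\<rho>. I N \<rho> + - L \<rho>) has_sum
        (integral {0..real N} (\<lambda>t. sym_g t * exp (- z * of_real t)) + - infsum L nontrivial_zeros)) nontrivial_zeros"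
      by (intro has_sum_add has_sum_uminusI I_sum has_sum_infsum L_summable)
    then show "((\<lambda>\<rho>. I N \<rho> - L \<rho>) has_sum
        (integral {0..real N} (\<lambda>t. sym_g t * exp (- z * of_real t)) - infsum L nontrivial_zeros)) nontrivial_zeros"
      by simp
    show "((\<lambda>\<rho>. norm (zero_weight \<rho>) * (8 * exp (- (real N / 2)))) has_sum W * (8 * exp (- (real N / 2)))) nontrivial_zeros"
      unfolding W_def by (intro has_sum_cmult_left has_sum_infsum zero_weight_summable)
  qed (rule diff)
  have "(\<lambda>N. integral {0..real N} (\<lambda>t. sym_g t * exp (- z * of_real t))) \<longlonglongrightarrow> infsum L nontrivial_zeros"
  proof (rule LIM_zero_cancel, rule Lim_null_comparison)
    show "\<forall>\<^sub>F N in sequentially. norm (integral {0..real N} (\<lambda>t. sym_g t * exp (- z * of_real t)) - infsum L nontrivial_zeros)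
      \<le> W * (8 * exp (- (real N / 2)))"
      using dist by simp
    show "(\<lambda>N. W * (8 * exp (- (real N / 2)))) \<longlonglongrightarrow> 0"
      by real_asymp
  qed
  moreover have "(\<lambda>N. integral {0..real N} (\<lambda>t. sym_g t * exp (- z * of_real t))) \<longlonglongrightarrow> laplace sym_g z"
    by (rule laplace_tendsto[OF sym_g_continuous growth]) (use z in auto)
  ultimately have "laplace sym_g z = infsum L nontrivial_zeros"
    using LIMSEQ_unique by blast
  then show ?thesis
    using has_sum_infsum[OF L_summable] by (simp add: L_def)
qed

text \<open>A nonconstant entire function has finitely many zeros in a compact set. Nonconstancy is
  seen by comparing the value at 2 with the value at some zero, so the case without zeros is split
  off.\<close>

lemma finite_nontrivial_zeros_cball: "finite {\<rho>\<in>nontrivial_zeros. norm (\<rho> - 1 / 2) \<le> r}"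
proof (cases "nontrivial_zeros = {}")
  case False
  then obtain \<rho>0 where \<rho>0: "\<rho>0 \<in> nontrivial_zeros" by blast
  show ?thesis
  proof (rule zeta_regularised)
    fix f :: "complex \<Rightarrow> complex"
    assume f: "f holomorphic_on UNIV" "\<And>s. s \<noteq> 1 \<Longrightarrow> f s = (s - 1) * riemann_zeta s"
    have zero: "f \<rho> = 0" if "\<rho> \<in> nontrivial_zeros" for \<rho>
    proof -
      have "\<rho> \<noteq> 1" "riemann_zeta \<rho> = 0" using that by (auto simp: nontrivial_zeros_def)
      then show ?thesis by (simp add: f(2))
    qed
    have "finite {z\<in>cball (1 / 2) r. f z = 0}"
    proof (rule holomorphic_compact_finite_zeros[OF f(1)])
      have "f 2 \<noteq> f \<rho>0"
        using zeta_nonzero_2 zero[OF \<rho>0] by (simp add: f(2))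
      then show "\<not> f constant_on UNIV"
        unfolding constant_on_def by (metis UNIV_I)
    qed (auto simp: connected_UNIV)
    then show ?thesis
      by (rule rev_finite_subset) (auto simp: zero dist_norm norm_minus_commute)
  qed
qed auto

text \<open>The residue of 1 / (z - b) at \<open>a\<close>, in a form that covers both cases and can
  be summed over finitely many zeros.\<close>

lemma tendsto_diff_quotient_pole:
  fixes a b :: complex
  shows "((\<lambda>z. (z - a) / (z - b)) \<longlongrightarrow> (if b = a then 1 else 0)) (at a)"
proof (cases "b = a")
  case True
  have "\<forall>\<^sub>F z in at a. 1 = (z - a) / (z - b)"
    using eventually_neq_at_within[of a a] by eventually_elim (use True in auto)
  then show ?thesis
    using True by (simp add: tendsto_eventually eventually_mono)
next
  case False
  have "((\<lambda>z. (z - a) / (z - b)) \<longlongrightarrow> (a - a) / (a - b)) (at a)"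
    by (intro tendsto_intros) (use False in auto)
  then show ?thesis using False by simp
qed

lemma screw_function_imp_RH:
  assumes screw: "screw_function g_H1"
  shows "Riemann_Hypothesis"
proof (rule ccontr)
  assume "\<not> Riemann_Hypothesis"
  then obtain \<rho>0 where \<rho>0: "\<rho>0 \<in> nontrivial_zeros" "Re \<rho>0 \<noteq> 1 / 2"
    by (auto simp: Riemann_Hypothesis_def)
  \<comment> \<open>The sign puts the pole into the right half-plane, where the transform is
    holomorphic.\<close>
  define a where "a = (if Re \<rho>0 > 1 / 2 then \<rho>0 - 1 / 2 else - (\<rho>0 - 1 / 2))"
  have a_cases: "\<rho>0 - 1 / 2 = a \<or> - (\<rho>0 - 1 / 2) = a" by (simp add: a_def)
  have a_pos: "Re a > 0" using \<rho>0(2) by (auto simp: a_def)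
  obtain C where growth: "\<And>t. t \<ge> 0 \<Longrightarrow> norm (sym_g t) \<le> C * (1 + t)\<^sup>2"
    using screw_function_growth[OF screw g_H1_0] unfolding sym_g_def by blast

  \<comment> \<open>The disc of radius \<open>R\<close> contains \<open>a\<close> and also the point
    2, which lies in the region where the two sides are first compared. Zeros farther than
    \<open>2 * R\<close> from 1/2 have their poles at distance at least \<open>R\<close> from every
    point of the disc.\<close>
  define R where "R = norm a + 3"
  define F where "F = {\<rho>\<in>nontrivial_zeros. norm (\<rho> - 1 / 2) \<le> 2 * R}"
  define G where "G = nontrivial_zeros - F"
  define D where "D = {z. Re z > 0} \<inter> ball 0 R"
  have R: "R \<ge> 3" by (simp add: R_def)
  have finF: "finite F" unfolding F_def by (rule finite_nontrivial_zeros_cball)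
  have FG: "F \<inter> G = {}" "F \<union> G = nontrivial_zeros" by (auto simp: F_def G_def)
  have aD: "a \<in> D" using a_pos by (simp add: D_def R_def)
  have openD: "open D" unfolding D_def by (intro open_Int open_halfspace_Re_gt open_ball)
  have convD: "convex D" unfolding D_def by (intro convex_Int convex_halfspace_Re_gt convex_ball)

  have far: "R \<le> norm (z - (\<rho> - 1 / 2))" "R \<le> norm (z + (\<rho> - 1 / 2))" if "\<rho> \<in> G" "norm z < R" for z \<rho>
  proof -
    have "norm (\<rho> - 1 / 2) > 2 * R" using that by (auto simp: F_def G_def)
    then show "R \<le> norm (z - (\<rho> - 1 / 2))" "R \<le> norm (z + (\<rho> - 1 / 2))"
      using that(2) norm_triangle_ineq2[of "\<rho> - 1 / 2" z] norm_diff_ineq[of "\<rho> - 1 / 2" z]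
      unfolding norm_minus_commute[of z] add.commute[of z] by linarith+
  qed
  define tail where "tail = (\<lambda>z. \<Sum>\<^sub>\<infinity>\<rho>\<in>G. zero_weight \<rho> * pole_term z \<rho>)"
  have tail_bound: "norm (zero_weight \<rho> * pole_term z \<rho>) \<le> norm (zero_weight \<rho>) * (2 / R)"
    if "\<rho> \<in> G" "norm z < R" for z \<rho>
  proof -
    have "norm (1 / (z - (\<rho> - 1 / 2))) \<le> 1 / R" "norm (1 / (z + (\<rho> - 1 / 2))) \<le> 1 / R"
      unfolding norm_divide norm_one using far[OF that] R by (auto intro!: frac_le)
    then have "norm (pole_term z \<rho>) \<le> 1 / R + 1 / R"
      unfolding pole_term_def by (intro norm_triangle_le add_mono)
    then show ?thesis
      unfolding norm_mult by (intro mult_left_mono) auto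
  qed
  have summG: "(\<lambda>\<rho>. norm (zero_weight \<rho>) * (2 / R)) summable_on G"
    by (intro summable_on_cmult_left summable_on_subset_banach[OF zero_weight_summable]) (auto simp: G_def)
  have tail_hol: "tail holomorphic_on ball 0 R"
    unfolding tail_def
  proof (rule holomorphic_on_infsum)
    fix \<rho> assume \<rho>: "\<rho> \<in> G"
    have "z - (\<rho> - 1 / 2) \<noteq> 0" "z + (\<rho> - 1 / 2) \<noteq> 0" if "z \<in> ball 0 R" for z
      using far[OF \<rho>, of z] that R by auto
    then show "(\<lambda>z. zero_weight \<rho> * pole_term z \<rho>) holomorphic_on ball 0 R"
      unfolding pole_term_def by (intro holomorphic_intros)
  next
    fix z :: complex assume "z \<in> ball 0 R"
    then obtain d where d: "d > 0" "cball z d \<subseteq> ball 0 R"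
      using open_contains_cball[of "ball 0 R"] open_ball by blast
    then show "\<exists>d>0. \<exists>M. cball z d \<subseteq> ball 0 R \<and> M summable_on G \<and>
        (\<forall>\<rho>\<in>G. \<forall>w\<in>cball z d. norm (zero_weight \<rho> * pole_term w \<rho>) \<le> M \<rho>)"
      using summG tail_bound
      by (intro exI[of _ d] conjI exI[of _ "\<lambda>\<rho>. norm (zero_weight \<rho>) * (2 / R)"]) auto
  qed simp
  define fin where "fin = (\<lambda>z. \<Sum>\<rho>\<in>F. zero_weight \<rho> * pole_term z \<rho>)"
  define W where "W = infsum zero_weight nontrivial_zeros"
  \<comment> \<open>The formula for \<open>laplace sym_g\<close>, solved for the finitely many pole
    terms near \<open>a\<close>. All ingredients are holomorphic on \<open>D\<close>, although
    \<open>fin\<close> is built from terms with poles there.\<close>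
  define h where "h = (\<lambda>z. W * (2 / z) - laplace sym_g z - tail z)"
  have h_hol: "h holomorphic_on D"
    unfolding h_def
    by (intro holomorphic_intros holomorphic_on_subset[OF laplace_holomorphic[OF sym_g_continuous growth]]
        holomorphic_on_subset[OF tail_hol]) (auto simp: D_def)
  have fin_right: "fin z = h z" if z: "norm z < R" "Re z > 1" for z
  proof -
    have "((\<lambda>\<rho>. zero_weight \<rho> * (2 / z) + - (zero_weight \<rho> * (2 / z - pole_term z \<rho>)))
        has_sum (W * (2 / z) + - laplace sym_g z)) nontrivial_zeros"
      unfolding W_def using z
      by (intro has_sum_add has_sum_uminusI has_sum_cmult_left has_sum_infsum zero_weight_abs_summable
          laplace_sym_g[where C = C] growth) auto
    then have "((\<lambda>\<rho>. zero_weight \<rho> * pole_term z \<rho>) has_sum (W * (2 / z) + - laplace sym_g z)) nontrivial_zeros"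
      by (simp add: algebra_simps)
    moreover have "(\<lambda>\<rho>. zero_weight \<rho> * pole_term z \<rho>) summable_on G"
      by (rule abs_summable_summable, rule Infinite_Sum.abs_summable_on_comparison_test'[OF summG])
         (rule tail_bound[OF _ z(1)])
    then have "((\<lambda>\<rho>. zero_weight \<rho> * pole_term z \<rho>) has_sum (fin z + tail z)) (F \<union> G)"
      unfolding fin_def tail_def using finF FG
      by (intro has_sum_Un_disjoint has_sum_finite has_sum_infsum) auto
    ultimately have "W * (2 / z) + - laplace sym_g z = fin z + tail z"
      unfolding FG by (rule has_sum_unique)
    then show ?thesis by (simp add: h_def algebra_simps)
  qed
  define P where "P = (\<lambda>\<rho>. \<rho> - 1 / 2) ` F \<union> (\<lambda>\<rho>. - (\<rho> - 1 / 2)) ` F"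
  have finP: "finite P" using finF by (simp add: P_def)
  have fin_hol: "fin holomorphic_on - P"
    unfolding fin_def pole_term_def
    by (intro holomorphic_intros) (auto simp: P_def add_eq_0_iff2 image_iff algebra_simps)
  \<comment> \<open>A convex open set stays connected when finitely many points are removed, so the
    identity spreads from \<open>Re z > 1\<close> to all of \<open>D\<close> outside
    \<open>P\<close>.\<close>
  have fin_eq: "fin z = h z" if "z \<in> D - P" for z
  proof (rule analytic_continuation_open[where f = fin and g = h and z = z
        and s = "D \<inter> {z. Re z > 1}" and s' = "D - P"])
    show "open (D \<inter> {z. Re z > 1})" by (intro open_Int openD open_halfspace_Re_gt)
    show "open (D - P)" using openD finP by (simp add: open_Diff finite_imp_closed)
    have "2 \<in> D \<inter> {z. Re z > 1}" using R by (simp add: D_def)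
    then show "D \<inter> {z. Re z > 1} \<noteq> {}" by blast
    show "connected (D - P)"
      by (rule connected_open_delete_finite[OF openD convex_connected[OF convD] _ finP]) simp
    have "\<bar>Re p\<bar> \<le> 1 / 2" if p: "p \<in> P" for p
    proof -
      obtain \<rho> where "\<rho> \<in> nontrivial_zeros" "p = \<rho> - 1 / 2 \<or> p = - (\<rho> - 1 / 2)"
        using p unfolding P_def F_def by blast
      then show ?thesis
        using nontrivial_zeros_Re[of \<rho>] by (auto simp only: uminus_complex.sel abs_minus)
    qed
    then show "D \<inter> {z. Re z > 1} \<subseteq> D - P" by fastforce
    show "fin holomorphic_on D - P" by (rule holomorphic_on_subset[OF fin_hol]) auto
    show "h holomorphic_on D - P" by (rule holomorphic_on_subset[OF h_hol]) auto
  qed (use that fin_right in \<open>auto simp: D_def\<close>)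

  \<comment> \<open>The residue of \<open>pole_term\<close> at \<open>a\<close>: the number of signs
    for which the pole of \<open>\<rho>\<close> lies there.\<close>
  define \<delta> where "\<delta> = (\<lambda>\<rho>. (if \<rho> - 1 / 2 = a then 1 else 0) + (if - (\<rho> - 1 / 2) = a then 1 else 0) :: real)"
  have \<delta>: "\<delta> \<rho> \<ge> 0" for \<rho> by (simp add: \<delta>_def)
  have "((\<lambda>z. (z - a) * fin z) \<longlongrightarrow> (\<Sum>\<rho>\<in>F. zero_weight \<rho> * of_real (\<delta> \<rho>))) (at a)"
  proof -
    have "((\<lambda>z. \<Sum>\<rho>\<in>F. zero_weight \<rho> * ((z - a) / (z - (\<rho> - 1 / 2)) + (z - a) / (z - (- (\<rho> - 1 / 2))))) \<longlongrightarrow>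
        (\<Sum>\<rho>\<in>F. zero_weight \<rho> * ((if \<rho> - 1 / 2 = a then 1 else 0) + (if - (\<rho> - 1 / 2) = a then 1 else 0)))) (at a)"
      by (intro tendsto_sum tendsto_mult tendsto_const tendsto_add tendsto_diff_quotient_pole)
    moreover have "complex_of_real (\<delta> \<rho>) = (if \<rho> - 1 / 2 = a then 1 else 0) + (if - (\<rho> - 1 / 2) = a then 1 else 0)" for \<rho>
      by (simp add: \<delta>_def)
    moreover have "(z - a) * fin z = (\<Sum>\<rho>\<in>F. zero_weight \<rho> * ((z - a) / (z - (\<rho> - 1 / 2)) + (z - a) / (z - (- (\<rho> - 1 / 2)))))" for z
    proof -
      have "(z - a) * (w * (1 / x + 1 / y)) = w * ((z - a) / x + (z - a) / y)" for w x y
        by (simp add: algebra_simps)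
      then show ?thesis
        unfolding fin_def pole_term_def sum_distrib_left by (simp only: diff_minus_eq_add)
    qed
    ultimately show ?thesis by (simp only:)
  qed
  moreover have "((\<lambda>z. (z - a) * fin z) \<longlongrightarrow> 0) (at a)"
  proof -
    have "continuous_on D h" using h_hol by (rule holomorphic_on_imp_continuous_on)
    then have "isCont h a" using openD aD by (simp add: continuous_on_eq_continuous_at)
    then have "((\<lambda>z. (z - a) * h z) \<longlongrightarrow> (a - a) * h a) (at a)"
      unfolding isCont_def by (intro tendsto_intros)
    then have "((\<lambda>z. (z - a) * h z) \<longlongrightarrow> 0) (at a)" by simp
    \<comment> \<open>\<open>a\<close> is itself in \<open>P\<close>; removing only the other poles
      leaves an open neighbourhood of \<open>a\<close>.\<close>
    moreover have "\<forall>\<^sub>F z in at a. z \<in> D - (P - {a}) - {a}"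
      by (rule eventually_at_in_open) (use openD finP aD in \<open>auto intro!: open_Diff finite_imp_closed\<close>)
    then have "\<forall>\<^sub>F z in at a. (z - a) * h z = (z - a) * fin z"
      by eventually_elim (use fin_eq in auto)
    ultimately show ?thesis by (rule Lim_transform_eventually)
  qed
  ultimately have c0: "(\<Sum>\<rho>\<in>F. zero_weight \<rho> * of_real (\<delta> \<rho>)) = 0"
    by (intro tendsto_unique[where F = "at a"]) auto
  \<comment> \<open>The value of \<open>\<rho> * (1 - \<rho>)\<close> shared by all zeros with a
    pole at \<open>a\<close>. Multiplying the residue by it leaves a sum of multiplicities, to which
    \<open>\<rho>0\<close> contributes a positive amount.\<close>
  define q where "q = 1 / 4 - a\<^sup>2"
  have q: "\<rho> * (1 - \<rho>) = q" if "\<rho> - 1 / 2 = a \<or> - (\<rho> - 1 / 2) = a" for \<rho>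
  proof -
    have "a\<^sup>2 = (\<rho> - 1 / 2)\<^sup>2" using that by (auto simp: power2_commute)
    then show ?thesis by (simp add: q_def power2_eq_square algebra_simps)
  qed
  have "q \<noteq> 0"
  proof -
    have "\<rho>0 \<noteq> 0" "1 - \<rho>0 \<noteq> 0" using \<rho>0 by (auto simp: nontrivial_zeros_def)
    then show ?thesis using q[OF a_cases] by auto
  qed
  have "zero_weight \<rho> * of_real (\<delta> \<rho>) * q = of_real (real_of_int (zorder riemann_zeta \<rho>) * \<delta> \<rho>)" for \<rho>
  proof (cases "\<rho> - 1 / 2 = a \<or> - (\<rho> - 1 / 2) = a")
    case True
    then show ?thesis using q[OF True] \<open>q \<noteq> 0\<close> by (simp add: zero_weight_def)
  next
    case False
    then have "\<delta> \<rho> = 0" by (simp add: \<delta>_def)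
    then show ?thesis by simp
  qed
  then have "complex_of_real (\<Sum>\<rho>\<in>F. real_of_int (zorder riemann_zeta \<rho>) * \<delta> \<rho>) = (\<Sum>\<rho>\<in>F. zero_weight \<rho> * of_real (\<delta> \<rho>)) * q"
    by (simp only: sum_distrib_right of_real_sum)
  then have "(\<Sum>\<rho>\<in>F. real_of_int (zorder riemann_zeta \<rho>) * \<delta> \<rho>) = 0"
    unfolding c0 by (simp only: mult_zero_left of_real_eq_0_iff)
  moreover have "(\<Sum>\<rho>\<in>F. real_of_int (zorder riemann_zeta \<rho>) * \<delta> \<rho>) > 0"
  proof (rule sum_pos2[OF finF])
    have "norm (\<rho>0 - 1 / 2) = norm a" by (simp only: a_def norm_minus_cancel split: if_split) simp
    then show "\<rho>0 \<in> F" using \<rho>0 R by (simp add: F_def R_def)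
    have "\<delta> \<rho>0 > 0" using a_cases by (auto simp only: \<delta>_def split: if_splits)
    then show "0 < real_of_int (zorder riemann_zeta \<rho>0) * \<delta> \<rho>0"
      using zorder_zeta_pos[OF \<rho>0(1)] by simp
    fix \<rho> assume "\<rho> \<in> F"
    then show "0 \<le> real_of_int (zorder riemann_zeta \<rho>) * \<delta> \<rho>"
      using zorder_zeta_pos[of \<rho>] \<delta>[of \<rho>] by (simp add: F_def)
  qed
  ultimately show False by simp
qed

theorem theorem1p3:
  shows "screw_function g_H1 \<longleftrightarrow> Riemann_Hypothesis"
  using screw_function_imp_RH RH_imp_screw_function by blast

end
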